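(* Let $n\ge 3$ be an integer. The number of shifted standard Young tableaux of truncated shape $\delta_n\setminus\delta_1$ is equal to $$g_n\,\frac{C_n\,C_{n-2}}{2\,C_{2n-3}},$$ where $g_n=\dfrac{\binom{n+1}{2}!}{\prod_{0\le i<j\le n}(i+j)}$ is the number of shifted standard Young tableaux of the (untruncated) shifted staircase shape $(n,n-1,\ldots,1)$ and $C_m=\frac{1}{m+1}\binom{2m}{m}$ is the $m$-th Catalan number.
   Context: Here $\delta_k=(k,k-1,\ldots,1)$. For integer partitions $\lambda,\mu$ with $\lambda_i\ge\mu_i$ for all $i$ (with $\mu_i=0$ beyond the length of $\mu$) and $\lambda$ having distinct parts, the shifted diagram of truncated shape $\lambda\setminus\mu$ is the array of boxes in which row $i$ (counted from the top) has $\lambda_i-\mu_i$ boxes and starts one box to the right of where row $i-1$ starts; i.e. row $i$ consists of the boxes in positions (row $i$, column $c$) with $i\le c\le i+\lambda_i-\mu_i-1$. Thus $\delta_n\setminus\delta_1$ is the shifted staircase with rows of lengths $n-1,n-1,n-2,\ldots,1$ (the shifted staircase $(n,n-1,\ldots,1)$ with the box in its upper right corner removed). A shifted standard Young tableau of such a shape with $N$ boxes is a filling of the boxes with the integers $1,\ldots,N$, each used exactly once, such that the entries increase along rows (left to right) and down columns. *)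

theory Defs
  imports Complex_Main "HOL-Library.FuncSet"
begin

text \<open>
  Integer partitions are weakly decreasing lists of positive naturals. Rows and parts are
  numbered from 1, and \<open>part xs i\<close> is 0 beyond the length of \<open>xs\<close>.
\<close>

definition part :: "nat list \<Rightarrow> nat \<Rightarrow> nat" where
  "part xs i = (if 1 \<le> i \<and> i \<le> length xs then xs ! (i - 1) else 0)"

definition staircase :: "nat \<Rightarrow> nat list" where
  "staircase k = rev [1..<k + 1]"

text \<open>
  Boxes are pairs (row, column). The definition is meant for \<open>\<lambda>\<close> with distinct parts and
  \<open>part \<mu> i \<le> part \<lambda> i\<close> for all \<open>i\<close>, so that the natural number subtraction is not
  truncated. The untruncated shifted diagram of \<open>\<lambda>\<close> is the case \<open>\<mu> = []\<close>.
\<close>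

definition shifted_diagram :: "nat list \<Rightarrow> nat list \<Rightarrow> (nat \<times> nat) set" where
  "shifted_diagram lam mu =
     {(i, c). 1 \<le> i \<and> i \<le> c \<and> c < i + (part lam i - part mu i)}"

text \<open>
  A filling is a function on boxes; membership in \<open>extensional D\<close> fixes its irrelevant values
  outside the diagram, so that the tableaux can be counted by \<open>card\<close>.
\<close>

definition standard_tableaux :: "(nat \<times> nat) set \<Rightarrow> (nat \<times> nat \<Rightarrow> nat) set" where
  "standard_tableaux D =
     {T \<in> extensional D.
        bij_betw T D {1..card D} \<and>
        (\<forall>i c c'. (i, c) \<in> D \<longrightarrow> (i, c') \<in> D \<longrightarrow> c < c' \<longrightarrow> T (i, c) < T (i, c')) \<and>
        (\<forall>i i' c. (i, c) \<in> D \<longrightarrow> (i', c) \<in> D \<longrightarrow> i < i' \<longrightarrow> T (i, c) < T (i', c))}"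

definition num_shifted_SYT :: "nat list \<Rightarrow> nat list \<Rightarrow> nat" where
  "num_shifted_SYT lam mu = card (standard_tableaux (shifted_diagram lam mu))"

definition g_staircase :: "nat \<Rightarrow> real" where
  "g_staircase n =
     fact ((n + 1) choose 2) / (\<Prod>(i, j)\<in>{(i, j). i < j \<and> j \<le> n}. real (i + j))"

definition catalan :: "nat \<Rightarrow> real" where
  "catalan m = 1 / (real m + 1) * real ((2 * m) choose m)"

end

theory Submission imports Defs begin

text \<open>
  In a truncated tableau the entry \<open>c\<close> of box \<open>(2, n - 1)\<close> lies between those of the two boxes
  \<open>(1, n - 1)\<close> and \<open>(2, n)\<close> next to the missing corner. Cutting the tableau at \<open>c\<close>, the boxes with
  smaller entries form the shifted diagram of a strict partition with set of parts
  \<open>{n - 1, n - 3} \<union> S\<close>, \<open>S \<subseteq> {1..n - 4}\<close>, and the boxes with larger entries, turned around, that of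
  \<open>{n - 1, n - 3} \<union> ({1..n - 4} - S)\<close>. By Schur's product formula for the number \<open>g\<close> of shifted
  tableaux, the factors relating the two largest parts to the rest multiply, over \<open>S\<close> and its
  complement, to a constant, and what remains depends on \<open>S\<close> only through
  \<open>g S * g ({1..n - 4} - S)\<close> and \<open>\<Sum>S\<close>. Summing \<open>g S * g ({1..n - 4} - S)\<close> over all \<open>S\<close> with
  \<open>\<Sum>S = t\<close> counts the tableaux of the full staircase of size \<open>n - 4\<close>, whatever \<open>t\<close> is, which
  leaves a Vandermonde convolution over \<open>t\<close>.
\<close>

section \<open>Linear extensions\<close>

text \<open>A linear extension is the list of the elements in the order of their labels. Only pairs
  related by \<open>r\<close> are constrained, so a relation such as \<open>before\<close>, which is
  not transitive, can be used directly, and the same \<open>r\<close> serves for all subsets of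
  \<open>D\<close>.\<close>

definition linear_exts :: "('a \<Rightarrow> 'a \<Rightarrow> bool) \<Rightarrow> 'a set \<Rightarrow> 'a list set" where
  "linear_exts r D = {xs. distinct xs \<and> set xs = D \<and> sorted_wrt (\<lambda>x y. \<not> r y x) xs}"

lemma finite_linear_exts: "finite D \<Longrightarrow> finite (linear_exts r D)"
  by (rule finite_subset[OF _ finite_subset_distinct[of D]]) (auto simp: linear_exts_def)

lemma linear_exts_empty: "linear_exts r {} = {[]}"
  by (auto simp: linear_exts_def)

text \<open>The last element must be maximal, and what precedes it is an arbitrary linear extension
  of the remaining elements.\<close>

lemma card_linear_exts_last:
  assumes "finite D" "D \<noteq> {}"
  shows "card (linear_exts r D) =
    (\<Sum>m\<in>{m \<in> D. \<forall>x\<in>D - {m}. \<not> r m x}. card (linear_exts r (D - {m})))"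
proof -
  let ?M = "{m \<in> D. \<forall>x\<in>D - {m}. \<not> r m x}"
  have "bij_betw (\<lambda>(m, ys). ys @ [m]) (SIGMA m:?M. linear_exts r (D - {m})) (linear_exts r D)"
  proof (rule bij_betw_byWitness[where f' = "\<lambda>xs. (last xs, butlast xs)"])
    show "(\<lambda>xs. (last xs, butlast xs)) ` linear_exts r D \<subseteq> (SIGMA m:?M. linear_exts r (D - {m}))"
    proof (clarify, intro conjI)
      fix xs assume xs: "xs \<in> linear_exts r D"
      then have "xs \<noteq> []" using assms by (auto simp: linear_exts_def)
      then obtain ys m where "xs = ys @ [m]" by (meson rev_exhaust)
      with xs show "last xs \<in> ?M" "butlast xs \<in> linear_exts r (D - {last xs})"
        by (auto simp: linear_exts_def sorted_wrt_append)
    qed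
    show "\<forall>xs\<in>linear_exts r D. (case (last xs, butlast xs) of (m, ys) \<Rightarrow> ys @ [m]) = xs"
      using assms by (auto simp: linear_exts_def intro!: append_butlast_last_id)
  qed (use assms in \<open>auto simp: linear_exts_def sorted_wrt_append\<close>)
  then have "card (linear_exts r D) = card (SIGMA m:?M. linear_exts r (D - {m}))"
    by (simp add: bij_betw_same_card)
  also have "\<dots> = (\<Sum>m\<in>?M. card (linear_exts r (D - {m})))"
    using assms by (intro card_SigmaI) (auto intro!: finite_linear_exts)
  finally show ?thesis .
qed

text \<open>Cutting a list at \<open>c\<close> singles out the set \<open>I\<close> of the elements
  before \<open>c\<close>. It is closed downwards and contains everything below \<open>c\<close>;
  given such an \<open>I\<close>, the orders before and after \<open>c\<close> can be chosen
  independently.\<close>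

lemma card_linear_exts_split:
  assumes "finite D" "c \<in> D" "\<not> r c c"
  shows "card (linear_exts r D) =
    (\<Sum>I\<in>{I. I \<subseteq> D - {c} \<and> (\<forall>x\<in>I. \<forall>y\<in>D. r y x \<longrightarrow> y \<in> I) \<and> (\<forall>y\<in>D. r y c \<longrightarrow> y \<in> I)}.
      card (linear_exts r I) * card (linear_exts r (D - I - {c})))"
proof -
  let ?J = "{I. I \<subseteq> D - {c} \<and> (\<forall>x\<in>I. \<forall>y\<in>D. r y x \<longrightarrow> y \<in> I) \<and> (\<forall>y\<in>D. r y c \<longrightarrow> y \<in> I)}"
  let ?L = "\<lambda>I. linear_exts r I \<times> linear_exts r (D - I - {c})"
  let ?f = "\<lambda>(I, ys, zs). ys @ c # zs"
  have "bij_betw ?f (SIGMA I:?J. ?L I) (linear_exts r D)"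
    unfolding bij_betw_def
  proof
    show "inj_on ?f (SIGMA I:?J. ?L I)"
    proof (rule inj_onI)
      fix p q assume p: "p \<in> (SIGMA I:?J. ?L I)" and q: "q \<in> (SIGMA I:?J. ?L I)" and "?f p = ?f q"
      obtain I ys zs where "p = (I, ys, zs)" by (cases p) auto
      moreover obtain I' ys' zs' where "q = (I', ys', zs')" by (cases q) auto
      ultimately have pq: "p = (I, ys, zs)" "q = (I', ys', zs')" by auto
      have sets: "set ys = I" "set ys' = I'" "c \<notin> I" "c \<notin> I'"
        using p q pq by (auto simp: linear_exts_def)
      moreover have "c \<notin> set zs"
        using p pq by (auto simp: linear_exts_def)
      moreover have "ys @ c # zs = ys' @ c # zs'"
        using \<open>?f p = ?f q\<close> pq by simp
      ultimately have "ys = ys' \<and> zs = zs'"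
        by (metis append_Cons_eq_iff)
      with sets pq show "p = q" by auto
    qed
    show "?f ` (SIGMA I:?J. ?L I) = linear_exts r D"
    proof
      show "?f ` (SIGMA I:?J. ?L I) \<subseteq> linear_exts r D"
      proof clarify
        fix I ys zs
        assume *: "I \<subseteq> D - {c}" "\<forall>x\<in>I. \<forall>y\<in>D. r y x \<longrightarrow> y \<in> I" "\<forall>y\<in>D. r y c \<longrightarrow> y \<in> I"
          and ys: "ys \<in> linear_exts r I" and zs: "zs \<in> linear_exts r (D - I - {c})"
        then have "set ys = I" "set zs = D - I - {c}" by (auto simp: linear_exts_def)
        moreover have "\<not> r c x" if "x \<in> I" for x using * that assms(2) by blast
        moreover have "\<not> r y x" if "x \<in> I" "y \<in> D - I" for x y using * that by blast
        moreover have "\<not> r y c" if "y \<in> D - I" for y using * that by blast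
        moreover have "distinct ys" "distinct zs" "sorted_wrt (\<lambda>x y. \<not> r y x) ys"
          "sorted_wrt (\<lambda>x y. \<not> r y x) zs"
          using ys zs by (simp_all add: linear_exts_def)
        moreover have "c \<notin> I" "I \<union> insert c (D - I - {c}) = D" using * assms(2) by auto
        moreover have "I \<inter> (D - I - {c}) = {}" by auto
        ultimately show "ys @ c # zs \<in> linear_exts r D"
          unfolding linear_exts_def mem_Collect_eq distinct_append sorted_wrt_append set_append
            distinct.simps sorted_wrt.simps list.set by simp
      qed
    next
      show "linear_exts r D \<subseteq> ?f ` (SIGMA I:?J. ?L I)"
      proof
        fix xs assume xs: "xs \<in> linear_exts r D"
        then have "c \<in> set xs" using assms by (auto simp: linear_exts_def)
        then obtain ys zs where eq: "xs = ys @ c # zs" by (meson split_list)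
        have "set ys \<in> ?J"
          using xs assms(3) eq by (auto simp: linear_exts_def sorted_wrt_append)
        moreover have "ys \<in> linear_exts r (set ys)"
          using xs eq by (auto simp: linear_exts_def sorted_wrt_append)
        moreover have "zs \<in> linear_exts r (D - set ys - {c})"
          using xs eq by (auto simp: linear_exts_def sorted_wrt_append)
        ultimately show "xs \<in> ?f ` (SIGMA I:?J. ?L I)"
          using eq by (intro image_eqI[of _ _ "(set ys, ys, zs)"]) auto
      qed
    qed
  qed
  then have "card (linear_exts r D) = card (SIGMA I:?J. ?L I)"
    by (simp add: bij_betw_same_card)
  also have "\<dots> = (\<Sum>I\<in>?J. card (?L I))"
  proof (intro card_SigmaI ballI)
    show "finite ?J" using assms(1) by (intro finite_subset[of ?J "Pow D"]) auto
    show "finite (?L I)" if "I \<in> ?J" for I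
      using that assms(1)
      by (intro finite_cartesian_product finite_linear_exts) (auto intro: finite_subset)
  qed
  finally show ?thesis by (simp add: card_cartesian_product)
qed

text \<open>An order-reversing bijection turns linear extensions around: map the list entrywise,
  then reverse it.\<close>

lemma card_linear_exts_dual:
  assumes "inj_on f D" "\<And>x y. x \<in> D \<Longrightarrow> y \<in> D \<Longrightarrow> r (f y) (f x) \<longleftrightarrow> r x y"
  shows "card (linear_exts r (f ` D)) = card (linear_exts r D)"
proof -
  have *: "map (inv_into D f) (map f xs) = xs" if "set xs \<subseteq> D" for xs
    using that assms(1) by (induction xs) auto
  have **: "map f (map (inv_into D f) xs) = xs" if "set xs \<subseteq> f ` D" for xs
    using that by (induction xs) (auto simp: f_inv_into_f)
  have "bij_betw (\<lambda>xs. rev (map f xs)) (linear_exts r D) (linear_exts r (f ` D))"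
  proof (rule bij_betw_byWitness[where f' = "\<lambda>xs. rev (map (inv_into D f) xs)"])
    show "\<forall>xs\<in>linear_exts r D. rev (map (inv_into D f) (rev (map f xs))) = xs"
      using * by (auto simp: linear_exts_def rev_map)
    show "\<forall>xs\<in>linear_exts r (f ` D). rev (map f (rev (map (inv_into D f) xs))) = xs"
      using ** by (auto simp: linear_exts_def rev_map)
    show "(\<lambda>xs. rev (map f xs)) ` linear_exts r D \<subseteq> linear_exts r (f ` D)"
    proof clarify
      fix xs assume xs: "xs \<in> linear_exts r D"
      have "sorted_wrt (\<lambda>x y. \<not> r (f x) (f y)) xs"
        by (rule sorted_wrt_mono_rel[where P = "\<lambda>x y. \<not> r y x"])
          (use xs assms(2) in \<open>auto simp: linear_exts_def\<close>)
      then show "rev (map f xs) \<in> linear_exts r (f ` D)"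
        using xs assms(1)
        by (auto simp: linear_exts_def sorted_wrt_rev sorted_wrt_map distinct_map)
    qed
    show "(\<lambda>xs. rev (map (inv_into D f) xs)) ` linear_exts r (f ` D) \<subseteq> linear_exts r D"
    proof clarify
      fix xs assume xs: "xs \<in> linear_exts r (f ` D)"
      let ?g = "inv_into D f"
      have "sorted_wrt (\<lambda>x y. \<not> r (?g x) (?g y)) xs"
      proof (rule sorted_wrt_mono_rel[rotated])
        show "sorted_wrt (\<lambda>x y. \<not> r y x) xs" using xs by (simp add: linear_exts_def)
        fix x y assume "x \<in> set xs" "y \<in> set xs" "\<not> r y x"
        then show "\<not> r (?g x) (?g y)"
          using xs assms(2)[of "?g x" "?g y"]
          by (auto simp: linear_exts_def f_inv_into_f inv_into_into)
      qed
      moreover have "distinct (map ?g xs)"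
        using xs by (auto simp: linear_exts_def distinct_map intro: inj_on_inv_into)
      moreover have "set (map ?g xs) = D"
        using xs assms(1) by (auto simp: linear_exts_def image_iff)
      ultimately show "rev (map ?g xs) \<in> linear_exts r D"
        by (simp add: linear_exts_def sorted_wrt_rev sorted_wrt_map)
    qed
  qed
  then show ?thesis by (simp add: bij_betw_same_card)
qed

section \<open>Standard tableaux as linear extensions\<close>

definition before :: "nat \<times> nat \<Rightarrow> nat \<times> nat \<Rightarrow> bool" where
  "before x y \<longleftrightarrow> fst x = fst y \<and> snd x < snd y \<or> snd x = snd y \<and> fst x < fst y"

lemma before_Pair [simp]:
  "before (i, c) (i', c') \<longleftrightarrow> i = i' \<and> c < c' \<or> c = c' \<and> i < i'"
  by (simp add: before_def)

lemma standard_tableaux_eq: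
  "standard_tableaux D = {T \<in> extensional D. bij_betw T D {1..card D} \<and>
     (\<forall>x\<in>D. \<forall>y\<in>D. before x y \<longrightarrow> T x < T y)}"
  unfolding standard_tableaux_def before_def by fastforce

text \<open>A tableau lists its boxes by increasing entry, and the entry of a box is recovered as
  its position in the list. \<open>F\<close> and \<open>H\<close> are these two translations; the
  \<open>Suc\<close> in them is there because list positions start at 0 and entries at 1.\<close>

lemma card_standard_tableaux:
  assumes "finite D"
  shows "card (standard_tableaux D) = card (linear_exts before D)"
proof -
  let ?N = "card D"
  define F where "F = (\<lambda>xs. restrict (\<lambda>x. Suc (inv_into {..<?N} ((!) xs) x)) D)"
  define H where "H = (\<lambda>T :: nat \<times> nat \<Rightarrow> nat. map (\<lambda>k. inv_into D T (Suc k)) [0..<?N])"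
  have F: "bij_betw ((!) xs) {..<?N} D" "length xs = ?N"
    "\<And>k. k < ?N \<Longrightarrow> F xs (xs ! k) = Suc k" if "xs \<in> linear_exts before D" for xs
  proof -
    have "distinct xs" "set xs = D" using that by (auto simp: linear_exts_def)
    then show l: "length xs = ?N" by (auto simp: distinct_card)
    show b: "bij_betw ((!) xs) {..<?N} D"
      using \<open>distinct xs\<close> \<open>set xs = D\<close> l by (auto intro!: bij_betw_nth)
    fix k assume "k < ?N"
    then show "F xs (xs ! k) = Suc k"
      using b l \<open>set xs = D\<close> by (auto simp: F_def bij_betw_def inv_into_f_f)
  qed
  have H: "H T ! k \<in> D" "T (H T ! k) = Suc k" if "T \<in> standard_tableaux D" "k < ?N" for T k
  proof -
    have b: "bij_betw T D {1..?N}" using that by (auto simp: standard_tableaux_eq)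
    have "Suc k \<in> T ` D" using b that by (auto simp: bij_betw_def)
    then show "H T ! k \<in> D" "T (H T ! k) = Suc k"
      using that by (auto simp: H_def f_inv_into_f inv_into_into)
  qed
  have "bij_betw F (linear_exts before D) (standard_tableaux D)"
  proof (rule bij_betw_byWitness[where f' = H])
    show FS: "F ` linear_exts before D \<subseteq> standard_tableaux D"
    proof clarify
      fix xs assume xs: "xs \<in> linear_exts before D"
      note b = F[OF xs]
      have s: "sorted_wrt (\<lambda>x y. \<not> before y x) xs" using xs by (simp add: linear_exts_def)
      have "F xs ` D = {1..?N}"
      proof -
        have "F xs ` D = F xs ` (!) xs ` {..<?N}" using b(1) by (simp add: bij_betw_def)
        also have "\<dots> = Suc ` {..<?N}" unfolding image_image using b(3) by auto
        also have "\<dots> = {1..?N}" by (simp add: lessThan_atLeast0 atLeastLessThanSuc_atLeastAtMost)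
        finally show ?thesis .
      qed
      \<comment> \<open>Injectivity follows from surjectivity onto a set of the same size.\<close>
      then have "bij_betw (F xs) D {1..?N}"
        using assms by (simp add: bij_betw_def eq_card_imp_inj_on)
      moreover have "F xs x < F xs y" if "x \<in> D" "y \<in> D" "before x y" for x y
      proof -
        have "x \<in> (!) xs ` {..<?N}" "y \<in> (!) xs ` {..<?N}"
          using that b(1) by (simp_all add: bij_betw_def)
        then obtain i j where ij: "i < ?N" "x = xs ! i" "j < ?N" "y = xs ! j"
          by (elim imageE) auto
        have "i \<noteq> j" using ij that by (auto simp: before_def)
        moreover have "\<not> j < i"
          using s ij that b(2) by (auto simp: sorted_wrt_iff_nth_less)
        ultimately show ?thesis using ij b(3) by auto
      qed
      ultimately show "F xs \<in> standard_tableaux D"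
        by (auto simp: standard_tableaux_eq F_def)
    qed
    show "H ` standard_tableaux D \<subseteq> linear_exts before D"
    proof clarify
      fix T assume T: "T \<in> standard_tableaux D"
      have l: "length (H T) = ?N" by (simp add: H_def)
      have d: "distinct (H T)"
        unfolding distinct_conv_nth using H(2)[OF T] l by (metis Suc_inject)
      have "set (H T) \<subseteq> D" using H(1)[OF T] l by (metis in_set_conv_nth subsetI)
      moreover have "card (set (H T)) = ?N" using d l by (simp add: distinct_card)
      ultimately have "set (H T) = D" using assms by (simp add: card_subset_eq)
      moreover have "sorted_wrt (\<lambda>x y. \<not> before y x) (H T)"
        unfolding sorted_wrt_iff_nth_less
      proof (intro allI impI notI)
        fix i j assume "i < j" "j < length (H T)" "before (H T ! j) (H T ! i)"
        moreover have "\<forall>x\<in>D. \<forall>y\<in>D. before x y \<longrightarrow> T x < T y"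
          using T by (simp add: standard_tableaux_eq)
        ultimately have "T (H T ! j) < T (H T ! i)" using H(1)[OF T] l by simp
        then show False using H(2)[OF T] l \<open>i < j\<close> \<open>j < length (H T)\<close> by simp
      qed
      ultimately show "H T \<in> linear_exts before D" using d by (simp add: linear_exts_def)
    qed
    then have HS: "T \<in> standard_tableaux D \<Longrightarrow> H T \<in> linear_exts before D" for T by auto
    show "\<forall>xs\<in>linear_exts before D. H (F xs) = xs"
    proof
      fix xs assume xs: "xs \<in> linear_exts before D"
      have T: "F xs \<in> standard_tableaux D" using FS xs by auto
      have inj: "inj_on (F xs) D" using T by (auto simp: standard_tableaux_eq bij_betw_def)
      show "H (F xs) = xs"
      proof (rule nth_equalityI)
        show "length (H (F xs)) = length xs" using F(2)[OF xs] by (simp add: H_def)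
        fix k assume "k < length (H (F xs))"
        then have k: "k < ?N" by (simp add: H_def)
        have "xs ! k \<in> D" using F(1)[OF xs] k by (auto simp: bij_betw_def)
        then show "H (F xs) ! k = xs ! k"
          using H[OF T k] F(3)[OF xs k] inj by (metis inj_onD)
      qed
    qed
    show "\<forall>T\<in>standard_tableaux D. F (H T) = T"
    proof
      fix T assume T: "T \<in> standard_tableaux D"
      show "F (H T) = T"
      proof (rule extensionalityI[of _ D])
        show "F (H T) \<in> extensional D" by (simp add: F_def)
        show "T \<in> extensional D" using T by (simp add: standard_tableaux_eq)
        fix x assume "x \<in> D"
        then have "x \<in> (!) (H T) ` {..<?N}"
          using F(1)[OF HS[OF T]] by (simp add: bij_betw_def)
        then obtain k where k: "k < ?N" "x = H T ! k" by (elim imageE) auto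
        then show "F (H T) x = T x" using F(3)[OF HS[OF T] k(1)] H[OF T k(1)] by simp
      qed
    qed
  qed
  then show ?thesis by (simp add: bij_betw_same_card)
qed

section \<open>Two summation identities\<close>

text \<open>The product is a rational function of \<open>u\<close> with at most simple poles, at the
  points \<open>x a\<close>, and with value 1 at infinity. The first identity is its partial
  fraction decomposition, the second compares the coefficients of \<open>1 / u\<close> at infinity.
  Both are proved together, adding one pole at a time.\<close>

lemma partial_fractions:
  fixes x w :: "'a \<Rightarrow> real"
  assumes "finite A" "inj_on x A"
  shows "u \<notin> x ` A \<Longrightarrow> (\<Prod>b\<in>A. (u - x b - w b) / (u - x b)) =
           1 - (\<Sum>a\<in>A. w a * (\<Prod>b\<in>A - {a}. (x a - x b - w b) / (x a - x b)) / (u - x a))"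
    and "(\<Sum>a\<in>A. w a * (\<Prod>b\<in>A - {a}. (x a - x b - w b) / (x a - x b))) = sum w A"
proof -
  \<comment> \<open>Used with \<open>d = u - x e\<close> and \<open>y = x e - x a\<close>, so that
    \<open>d + y = u - x a\<close>; it separates the new pole \<open>x e\<close> from the old pole
    \<open>x a\<close>.\<close>
  have frac: "c * (1 - e / - y) / (d + y) = c / (d + y) + e / d * (c / y) - e / d * (c / (d + y))"
    if "d \<noteq> 0" "y \<noteq> 0" "d + y \<noteq> 0" for c d e y :: real
    using that by (simp add: divide_simps) (simp add: algebra_simps)
  \<comment> \<open>Here \<open>q\<close> stands for \<open>w e / (u - x e)\<close>, and
    \<open>X\<close> and \<open>Y\<close> for the partial fraction sums over \<open>A\<close> at
    \<open>u\<close> and at \<open>x e\<close>.\<close>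
  have expand: "(1 - q) * (1 - X) = 1 - (q * (1 - Y) + (X + q * Y - q * X))" for q X Y :: real
    by (simp add: algebra_simps)
  define R where "R = (\<lambda>A a. \<Prod>b\<in>A - {a}. (x a - x b - w b) / (x a - x b))"
  have "(\<forall>u. u \<notin> x ` A \<longrightarrow> (\<Prod>b\<in>A. (u - x b - w b) / (u - x b)) =
           1 - (\<Sum>a\<in>A. w a * R A a / (u - x a))) \<and> (\<Sum>a\<in>A. w a * R A a) = sum w A"
    using assms
  proof (induction A rule: finite_induct)
    case (insert e A)
    have ne: "x a \<noteq> x e" if "a \<in> A" for a using insert that by (auto simp: inj_on_def)
    have IH: "\<And>u. u \<notin> x ` A \<Longrightarrow> (\<Prod>b\<in>A. (u - x b - w b) / (u - x b)) =
           1 - (\<Sum>a\<in>A. w a * R A a / (u - x a))" "(\<Sum>a\<in>A. w a * R A a) = sum w A"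
      using insert by auto
    have Ra: "R (insert e A) a = R A a * (1 - w e / (x a - x e))" if "a \<in> A" for a
    proof -
      have "insert e A - {a} = insert e (A - {a})" using insert that by auto
      then show ?thesis using insert that ne[OF that] by (simp add: R_def field_simps)
    qed
    \<comment> \<open>The coefficient at the new pole is the old product evaluated at
      \<open>u = x e\<close>, which the induction hypothesis expands.\<close>
    have Re: "R (insert e A) e = 1 - (\<Sum>a\<in>A. w a * R A a / (x e - x a))"
    proof -
      have "insert e A - {e} = A" using insert by auto
      moreover have "x e \<notin> x ` A" using ne by force
      ultimately show ?thesis using IH(1) by (simp add: R_def)
    qed
    have "(\<Prod>b\<in>insert e A. (u - x b - w b) / (u - x b)) =
           1 - (\<Sum>a\<in>insert e A. w a * R (insert e A) a / (u - x a))" if u: "u \<notin> x ` insert e A" for u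
    proof -
      have ue: "u \<noteq> x e" "\<And>a. a \<in> A \<Longrightarrow> u \<noteq> x a" using u by auto
      have "(\<Sum>a\<in>A. w a * R (insert e A) a / (u - x a)) =
        (\<Sum>a\<in>A. w a * R A a / (u - x a) + w e / (u - x e) * (w a * R A a / (x e - x a))
              - w e / (u - x e) * (w a * R A a / (u - x a)))"
      proof (rule sum.cong[OF refl])
        fix a assume a: "a \<in> A"
        have "u - x e \<noteq> 0" "x e - x a \<noteq> 0" "(u - x e) + (x e - x a) \<noteq> 0"
          using ue a ne[OF a] by auto
        from frac[OF this, of "w a * R A a" "w e"]
        show "w a * R (insert e A) a / (u - x a) =
          w a * R A a / (u - x a) + w e / (u - x e) * (w a * R A a / (x e - x a))
              - w e / (u - x e) * (w a * R A a / (u - x a))"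
          unfolding Ra[OF a] by (simp add: mult.assoc)
      qed
      also have "\<dots> = (\<Sum>a\<in>A. w a * R A a / (u - x a)) +
          w e / (u - x e) * (\<Sum>a\<in>A. w a * R A a / (x e - x a))
          - w e / (u - x e) * (\<Sum>a\<in>A. w a * R A a / (u - x a))"
        by (simp add: sum.distrib sum_subtractf sum_distrib_left)
      finally have S: "(\<Sum>a\<in>A. w a * R (insert e A) a / (u - x a)) = \<dots>" .
      have "(\<Prod>b\<in>insert e A. (u - x b - w b) / (u - x b)) =
          (1 - w e / (u - x e)) * (1 - (\<Sum>a\<in>A. w a * R A a / (u - x a)))"
      proof -
        have "u \<notin> x ` A" using u by auto
        moreover have "(u - x e - w e) / (u - x e) = 1 - w e / (u - x e)"
          using ue(1) by (simp add: diff_divide_distrib)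
        ultimately show ?thesis using insert.hyps IH(1)[of u] by simp
      qed
      moreover have "(\<Sum>a\<in>insert e A. w a * R (insert e A) a / (u - x a)) =
          w e / (u - x e) * R (insert e A) e + (\<Sum>a\<in>A. w a * R (insert e A) a / (u - x a))"
        using insert.hyps by simp
      ultimately show ?thesis
        unfolding S Re by (simp only: expand)
    qed
    moreover have "(\<Sum>a\<in>insert e A. w a * R (insert e A) a) = sum w (insert e A)"
    proof -
      have "(\<Sum>a\<in>A. w a * R (insert e A) a) =
         (\<Sum>a\<in>A. w a * R A a + w e * (w a * R A a / (x e - x a)))"
      proof (rule sum.cong[OF refl])
        fix a assume a: "a \<in> A"
        have "w e / (x a - x e) = - (w e / (x e - x a))"
          by (metis minus_diff_eq minus_divide_right)
        then show "w a * R (insert e A) a = w a * R A a + w e * (w a * R A a / (x e - x a))"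
          unfolding Ra[OF a] by (simp add: algebra_simps)
      qed
      also have "\<dots> = sum w A + w e * (\<Sum>a\<in>A. w a * R A a / (x e - x a))"
        by (simp add: sum.distrib sum_distrib_left IH(2))
      finally show ?thesis using insert by (simp add: Re algebra_simps)
    qed
    ultimately show ?case by blast
  qed simp
  then show "u \<notin> x ` A \<Longrightarrow> (\<Prod>b\<in>A. (u - x b - w b) / (u - x b)) =
           1 - (\<Sum>a\<in>A. w a * (\<Prod>b\<in>A - {a}. (x a - x b - w b) / (x a - x b)) / (u - x a))"
    and "(\<Sum>a\<in>A. w a * (\<Prod>b\<in>A - {a}. (x a - x b - w b) / (x a - x b))) = sum w A"
    by (auto simp: R_def)
qed

text \<open>A Vandermonde convolution in the upper indices. Combinatorially, it sorts the subsets
  with \<open>p + q + 1\<close> elements of \<open>{1..M + p + q + 1}\<close> by their element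
  number \<open>p + 1\<close> in increasing order. The proof is by induction on \<open>q\<close> and
  \<open>M\<close>.\<close>

lemma sum_choose_mult_choose:
  "(\<Sum>t\<le>M. ((t + p) choose p) * ((M - t + q) choose q)) = (M + p + q + 1) choose (p + q + 1)"
proof (induction q arbitrary: M)
  case 0
  show ?case by (induction M) auto
next
  case IH: (Suc q)
  show ?case
  proof (induction M)
    case (Suc M)
    \<comment> \<open>Pascal's rule for the second factor. For \<open>t = Suc M\<close> that factor
      is 1 for both lower indices, so this term appears only in the second sum.\<close>
    have "(\<Sum>t\<le>Suc M. ((t + p) choose p) * ((Suc M - t + Suc q) choose Suc q)) =
      (\<Sum>t\<le>M. ((t + p) choose p) * ((M - t + Suc q) choose Suc q)) +
      (\<Sum>t\<le>Suc M. ((t + p) choose p) * ((Suc M - t + q) choose q))"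
      by (simp add: sum.distrib[symmetric] Suc_diff_le algebra_simps)
    also have "\<dots> = (Suc M + p + Suc q + 1) choose (p + Suc q + 1)"
      unfolding Suc.IH IH by simp
    finally show ?case .
  qed simp
qed

section \<open>Schur's product formula\<close>

text \<open>The absolute value makes the factor symmetric, so that a part can be paired with all
  others regardless of their size. A part 0 has factor 1 with every positive part.\<close>

definition pair_factor :: "nat \<Rightarrow> nat \<Rightarrow> real" where
  "pair_factor a b = \<bar>real a - real b\<bar> / (real a + real b)"

text \<open>Schur's formula for the number of shifted standard tableaux of the shape with set of
  parts \<open>A\<close>; \<open>card_linear_exts_boxes\<close> proves that it counts them.\<close>

definition schur_count :: "nat set \<Rightarrow> real" where
  "schur_count A = fact (\<Sum>A) / (\<Prod>a\<in>A. fact a) *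
     (\<Prod>(a, b)\<in>{(a, b). a \<in> A \<and> b \<in> A \<and> a < b}. pair_factor a b)"

lemma schur_count_empty [simp]: "schur_count {} = 1"
  by (simp add: schur_count_def)

lemma schur_count_insert:
  assumes "finite A" "u \<notin> A"
  shows "schur_count (insert u A) =
    schur_count A * fact (\<Sum>A + u) / fact (\<Sum>A) / fact u * (\<Prod>a\<in>A. pair_factor u a)"
proof -
  let ?P = "\<lambda>A. {(a, b). a \<in> A \<and> b \<in> A \<and> a < b}"
  \<comment> \<open>\<open>?f\<close> gives the new pairs, those of \<open>u\<close> with an element
    of \<open>A\<close>, with the smaller entry first as the index set of the product
    requires.\<close>
  let ?f = "\<lambda>a. (min u a, max u a)"
  have "?f ` A = {(a, b). a \<in> A \<and> b = u \<and> a < b} \<union> {(a, b). a = u \<and> b \<in> A \<and> a < b}" (is "_ = ?Q")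
  proof
    show "?f ` A \<subseteq> ?Q"
    proof (rule image_subsetI)
      fix a assume "a \<in> A"
      then show "?f a \<in> ?Q"
        using assms by (cases a u rule: linorder_cases) auto
    qed
    show "?Q \<subseteq> ?f ` A"
    proof clarify
      fix a b assume "(a, b) \<in> ?Q"
      then have "(a, b) = ?f a \<and> a \<in> A \<or> (a, b) = ?f b \<and> b \<in> A"
        by (auto simp: min_def max_def)
      then show "(a, b) \<in> ?f ` A" by blast
    qed
  qed
  then have eq: "?P (insert u A) = ?P A \<union> ?f ` A" by auto
  have inj: "inj_on ?f A"
    by (auto simp: inj_on_def min_def max_def split: if_splits)
  have "finite (?P A)" by (rule finite_subset[of _ "A \<times> A"]) (use assms in auto)
  moreover have "?P A \<inter> ?f ` A = {}" using assms by (auto simp: min_def max_def split: if_splits)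
  ultimately have "(\<Prod>(a, b)\<in>?P (insert u A). pair_factor a b) =
      (\<Prod>(a, b)\<in>?P A. pair_factor a b) * (\<Prod>(a, b)\<in>?f ` A. pair_factor a b)"
    unfolding eq using assms by (intro prod.union_disjoint) auto
  also have "(\<Prod>(a, b)\<in>?f ` A. pair_factor a b) = (\<Prod>a\<in>A. pair_factor u a)"
    by (subst prod.reindex[OF inj])
      (auto intro!: prod.cong simp: pair_factor_def min_def max_def add.commute)
  finally have E: "(\<Prod>(a, b)\<in>?P (insert u A). pair_factor a b) =
      (\<Prod>(a, b)\<in>?P A. pair_factor a b) * (\<Prod>a\<in>A. pair_factor u a)" .
  show ?thesis unfolding schur_count_def E using assms by (simp add: ac_simps)
qed

text \<open>Lowering the part 1 produces a 0, which may be dropped because its factorial and its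
  pair factors with positive parts are 1.\<close>

lemma schur_count_Diff_0: "finite A \<Longrightarrow> schur_count (A - {0}) = schur_count A"
proof (cases "0 \<in> A")
  case True
  assume A: "finite A"
  have "schur_count (insert 0 (A - {0})) = schur_count (A - {0}) * (\<Prod>a\<in>A - {0}. pair_factor 0 a)"
    using A by (subst schur_count_insert) auto
  also have "(\<Prod>a\<in>A - {0}. pair_factor 0 a) = 1"
    by (intro prod.neutral) (auto simp: pair_factor_def)
  finally show ?thesis using True by (simp add: insert_absorb)
qed simp

lemma schur_count_pos: "finite A \<Longrightarrow> schur_count A > 0"
  by (auto simp: schur_count_def pair_factor_def intro!: mult_pos_pos divide_pos_pos prod_pos)

text \<open>
  With \<open>X a = a * (a - 1)\<close> the quotients of consecutive terms become partial fraction
  coefficients: \<open>X a - b * (b + 1) = (a - 1 - b) * (a + b)\<close> and \<open>X a - X b = (a - b) * (a - 1 + b)\<close>.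
\<close>

lemma schur_count_rec:
  assumes "finite A" "0 \<notin> A" "A \<noteq> {}"
  shows "schur_count A = (\<Sum>a | a \<in> A \<and> a - 1 \<notin> A. schur_count (insert (a - 1) (A - {a})))"
proof -
  define N where "N = \<Sum>A"
  define X where "X = (\<lambda>a. real a * (real a - 1))"
  \<comment> \<open>With this weight \<open>X b + W b = b * (b + 1)\<close>, and the weights add up
    to \<open>2 * N\<close>, which is how the second identity of \<open>partial_fractions\<close>
    evaluates the recursion.\<close>
  define W where "W = (\<lambda>a. 2 * real a)"
  define R where "R = (\<lambda>a. \<Prod>b\<in>A - {a}. (X a - X b - W b) / (X a - X b))"
  have "N > 0" using assms by (auto simp: N_def intro!: Nat.gr0I)
  have factor: "X a - X b - W b = (real a - 1 - real b) * (real a + real b)"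
    "X a - X b = (real a - real b) * (real a - 1 + real b)" for a b
    by (simp_all add: X_def W_def algebra_simps)
  have "inj_on X A"
  proof (rule inj_onI)
    fix a b assume ab: "a \<in> A" "b \<in> A" "X a = X b"
    then have "a > 0" "b > 0" using assms by (auto intro!: Nat.gr0I)
    then have "real a - 1 + real b \<noteq> 0" by simp
    moreover have "(real a - real b) * (real a - 1 + real b) = 0"
      using ab(3) factor(2)[of a b] by simp
    ultimately show "a = b" by simp
  qed
  then have sum: "(\<Sum>a\<in>A. W a * R a) = sum W A"
    unfolding R_def using assms by (intro partial_fractions)
  \<comment> \<open>Passing from \<open>a\<close> to \<open>a - 1\<close> multiplies the factorials
    by \<open>a / N\<close> and the pair factors by \<open>R a\<close>.\<close>
  have low: "schur_count (insert (a - 1) (A - {a})) = schur_count A / real N * (real a * R a)"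
    if a: "a \<in> A" "a - 1 \<notin> A" for a
  proof -
    have "a > 0" using a assms by (auto intro!: Nat.gr0I)
    have Na: "N = \<Sum>(A - {a}) + a" using a assms by (simp add: N_def sum.remove add.commute)
    have "pair_factor (a - 1) b = pair_factor a b * ((X a - X b - W b) / (X a - X b))"
      if b: "b \<in> A - {a}" for b
    proof -
      have b: "b \<noteq> a" "b \<noteq> a - 1" "b > 0" using b a assms by (auto intro!: Nat.gr0I)
      have r: "real (a - 1) = real a - 1" using \<open>a > 0\<close> by (simp add: of_nat_diff)
      \<comment> \<open>As \<open>a\<close> and \<open>b\<close> are integers,
        \<open>a - 1 - b\<close> and \<open>a - b\<close> never have opposite signs, so the absolute
        values in the pair factors can be removed.\<close>
      have abs: "\<bar>real a - 1 - real b\<bar> * (real a - real b) = (real a - 1 - real b) * \<bar>real a - real b\<bar>"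
      proof (cases "a \<le> b")
        case False
        then have "real a - 1 - real b \<ge> 0" "real a - real b \<ge> 0" by linarith+
        then show ?thesis by simp
      qed (auto simp: abs_if algebra_simps)
      have "real a - real b \<noteq> 0" "real a - 1 + real b \<noteq> 0" "real a + real b \<noteq> 0"
        using b \<open>a > 0\<close> by auto
      then show ?thesis
        unfolding pair_factor_def r factor(1) unfolding factor(2) using abs
        by (simp add: frac_eq_eq)
    qed
    then have "(\<Prod>b\<in>A - {a}. pair_factor (a - 1) b) =
        (\<Prod>b\<in>A - {a}. pair_factor a b * ((X a - X b - W b) / (X a - X b)))"
      by (intro prod.cong refl)
    also have "\<dots> = (\<Prod>b\<in>A - {a}. pair_factor a b) * R a"
      unfolding R_def by (rule prod.distrib)
    finally have "(\<Prod>b\<in>A - {a}. pair_factor (a - 1) b) = \<dots>" .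
    moreover have "schur_count A = schur_count (A - {a}) * fact N /
        fact (\<Sum>(A - {a})) / fact a * (\<Prod>b\<in>A - {a}. pair_factor a b)"
      using schur_count_insert[of "A - {a}" a] assms a Na by (simp add: insert_absorb)
    moreover have "schur_count (insert (a - 1) (A - {a})) = schur_count (A - {a}) * fact (N - 1) /
        fact (\<Sum>(A - {a})) / fact (a - 1) * (\<Prod>b\<in>A - {a}. pair_factor (a - 1) b)"
      using schur_count_insert[of "A - {a}" "a - 1"] assms a Na \<open>a > 0\<close> by simp
    moreover have "fact N = real N * fact (N - 1)" "fact a = real a * fact (a - 1)"
      using \<open>N > 0\<close> \<open>a > 0\<close> by (simp_all add: fact_reduce)
    moreover have "real N \<noteq> 0" "real a \<noteq> 0" using \<open>N > 0\<close> \<open>a > 0\<close> by simp_all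
    ultimately show ?thesis by (simp only:) (simp add: divide_simps)
  qed
  \<comment> \<open>If \<open>a - 1\<close> is also a part, the factor of \<open>R a\<close> for
    \<open>b = a - 1\<close> vanishes, so the sum over the parts that can be lowered extends to all
    of \<open>A\<close>.\<close>
  have zero: "R a = 0" if a: "a \<in> A" "a - 1 \<in> A" for a
  proof -
    have "a > 0" using a assms by (auto intro!: Nat.gr0I)
    then have "a - 1 \<in> A - {a}" using a by auto
    moreover have "X a - X (a - 1) - W (a - 1) = 0"
      unfolding factor(1) using \<open>a > 0\<close> by (simp add: of_nat_diff)
    ultimately show ?thesis unfolding R_def using assms by (intro prod_zero) (auto intro!: bexI[of _ "a - 1"])
  qed
  have "(\<Sum>a | a \<in> A \<and> a - 1 \<notin> A. schur_count (insert (a - 1) (A - {a}))) =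
     (\<Sum>a | a \<in> A \<and> a - 1 \<notin> A. schur_count A / real N * (real a * R a))"
    by (intro sum.cong) (use low in auto)
  also have "\<dots> = (\<Sum>a\<in>A. schur_count A / real N * (real a * R a))"
    using assms zero by (intro sum.mono_neutral_left) auto
  also have "\<dots> = schur_count A / real N * ((\<Sum>a\<in>A. W a * R a) / 2)"
    by (simp add: W_def sum_distrib_left sum_divide_distrib)
  also have "(\<Sum>a\<in>A. W a * R a) / 2 = real N"
    unfolding sum by (simp add: W_def N_def sum_distrib_left[symmetric])
  finally show ?thesis using \<open>N > 0\<close> by simp
qed

section \<open>Lowering parts in complementary sets\<close>

text \<open>Dropping 0 keeps the result inside \<open>{1..m}\<close>, where complements are
  taken.\<close>

definition lower :: "nat \<Rightarrow> nat set \<Rightarrow> nat set" where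
  "lower a A = insert (a - 1) (A - {a}) - {0}"

text \<open>Moving \<open>a\<close> down to \<open>a - 1\<close> in \<open>A\<close> moves
  \<open>a - 1\<close> up to \<open>a\<close> in the complement, so lowering \<open>a\<close> in the
  new complement restores the old one. For \<open>a = 1\<close> the element 1 leaves
  \<open>A\<close> and enters the complement.\<close>

lemma lower_properties:
  assumes "A \<subseteq> {1..m}" "a \<in> A" "a - 1 \<notin> A"
  shows "lower a A \<subseteq> {1..m}" "a \<in> {1..m} - lower a A" "a - 1 \<notin> {1..m} - lower a A"
    "lower a ({1..m} - lower a A) = {1..m} - A" "\<Sum>A = Suc (\<Sum>(lower a A))"
proof -
  have "a \<ge> 1" "a \<le> m" using assms by auto
  show "lower a A \<subseteq> {1..m}" "a \<in> {1..m} - lower a A" "a - 1 \<notin> {1..m} - lower a A"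
    using assms \<open>a \<ge> 1\<close> \<open>a \<le> m\<close> by (fastforce simp: lower_def)+
  show "lower a ({1..m} - lower a A) = {1..m} - A"
    using assms \<open>a \<ge> 1\<close> \<open>a \<le> m\<close> by (fastforce simp: lower_def)
  have fin: "finite A" using assms finite_subset by blast
  have "\<Sum>(lower a A) = \<Sum>(insert (a - 1) (A - {a}))"
    using fin by (auto simp: lower_def intro!: sum.mono_neutral_left)
  also have "\<dots> = (a - 1) + \<Sum>(A - {a})" using assms fin by simp
  finally show "\<Sum>A = Suc (\<Sum>(lower a A))"
    using fin assms \<open>a \<ge> 1\<close> by (simp add: sum.remove)
qed

lemma schur_count_lower:
  assumes "A \<subseteq> {1..m}" "A \<noteq> {}"
  shows "schur_count A = (\<Sum>a | a \<in> A \<and> a - 1 \<notin> A. schur_count (lower a A))"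
proof -
  have fin: "finite A" using assms finite_subset by blast
  have "schur_count A = (\<Sum>a | a \<in> A \<and> a - 1 \<notin> A. schur_count (insert (a - 1) (A - {a})))"
    using assms fin by (intro schur_count_rec) auto
  also have "\<dots> = (\<Sum>a | a \<in> A \<and> a - 1 \<notin> A. schur_count (lower a A))"
    using fin unfolding lower_def by (intro sum.cong refl schur_count_Diff_0[symmetric]) auto
  finally show ?thesis .
qed

lemma sum_Diff_atLeastAtMost: "A \<subseteq> {1..m} \<Longrightarrow> \<Sum>({1..m} - A) = \<Sum>{1..m} - \<Sum>(A :: nat set)"
  by (intro sum_diff_nat) (auto intro: finite_subset)

lemma sum_subset_le: "A \<subseteq> {1..m} \<Longrightarrow> \<Sum>A \<le> \<Sum>{1..m :: nat}"
  by (intro sum_mono2) auto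

text \<open>
  The sum is independent of \<open>t\<close>: lowering a part of \<open>A\<close> raises a part of the complement, so
  applying the recursion to the first factor for \<open>t + 1\<close> and to the second factor for \<open>t\<close> gives
  the same sum over pairs of neighbouring sets.
\<close>

lemma sum_complementary:
  assumes "t \<le> \<Sum>{1..m}"
  shows "(\<Sum>A | A \<subseteq> {1..m} \<and> \<Sum>A = t. schur_count A * schur_count ({1..m} - A)) =
    schur_count {1..m}"
  using assms
proof (induction t)
  case 0
  have "\<Sum>A = 0 \<longleftrightarrow> A = {}" if "A \<subseteq> {1..m}" for A
    using that finite_subset[OF that] by (auto simp: subset_iff)
  then have "{A. A \<subseteq> {1..m} \<and> \<Sum>A = 0} = {{}}" by auto
  then show ?case by simp
next
  case (Suc t)
  let ?S = "\<lambda>t. {A. A \<subseteq> {1..m} \<and> \<Sum>A = t}"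
  let ?L = "\<lambda>A. {a. a \<in> A \<and> a - 1 \<notin> A}"
  let ?C = "\<lambda>A. {1..m} - A"
  have finS: "finite (?S t)" for t by (rule finite_subset[of _ "Pow {1..m}"]) auto
  have finL: "A \<subseteq> {1..m} \<Longrightarrow> finite (?L A)" for A by (auto intro: finite_subset)
  have dbl: "?C (?C A) = A" if "A \<subseteq> {1..m}" for A using that by auto
  have "(\<Sum>A\<in>?S (Suc t). schur_count A * schur_count (?C A)) =
      (\<Sum>A\<in>?S (Suc t). \<Sum>a\<in>?L A. schur_count (lower a A) * schur_count (?C A))"
  proof (intro sum.cong refl)
    fix A assume "A \<in> ?S (Suc t)"
    then have "A \<subseteq> {1..m}" "A \<noteq> {}" by auto
    then show "schur_count A * schur_count (?C A) =
        (\<Sum>a\<in>?L A. schur_count (lower a A) * schur_count (?C A))"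
      by (subst schur_count_lower[of A m]) (simp_all add: sum_distrib_right)
  qed
  also have "\<dots> = (\<Sum>(A, a)\<in>Sigma (?S (Suc t)) ?L. schur_count (lower a A) * schur_count (?C A))"
    using finS finL by (intro sum.Sigma) auto
  \<comment> \<open>The pair \<open>(A, a)\<close> goes to \<open>(lower a A, a)\<close>; the way
    back lowers \<open>a\<close> in the complement and takes the complement again.\<close>
  also have "\<dots> = (\<Sum>(B, a)\<in>Sigma (?S t) (\<lambda>B. ?L (?C B)). schur_count B * schur_count (lower a (?C B)))"
  proof (rule sum.reindex_bij_witness[where i = "\<lambda>(B, a). (?C (lower a (?C B)), a)"
        and j = "\<lambda>(A, a). (lower a A, a)"], goal_cases)
    case (1 p)
    then obtain A a where p: "p = (A, a)" "A \<subseteq> {1..m}" "a \<in> A" "a - 1 \<notin> A" by auto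
    show ?case using lower_properties[OF p(2-4)] dbl[OF p(2)] p(1) by simp
  next
    case (2 p)
    then obtain A a where p: "p = (A, a)" "A \<subseteq> {1..m}" "a \<in> A" "a - 1 \<notin> A" "\<Sum>A = Suc t" by auto
    show ?case using lower_properties[OF p(2-4)] p(1,5) by simp
  next
    case (3 p)
    then obtain B a where p: "p = (B, a)" "B \<subseteq> {1..m}" "a \<in> ?C B" "a - 1 \<notin> ?C B" by auto
    show ?case using lower_properties[OF _ p(3,4)] dbl[OF p(2)] p(1) by simp
  next
    case (4 p)
    then obtain B a where p: "p = (B, a)" "B \<subseteq> {1..m}" "a \<in> ?C B" "a - 1 \<notin> ?C B" "\<Sum>B = t" by auto
    have *: "?C B \<subseteq> {1..m}" by auto
    note l = lower_properties[OF * p(3,4)]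
    have "\<Sum>(?C (lower a (?C B))) = \<Sum>{1..m} - \<Sum>(lower a (?C B))"
      using l(1) by (rule sum_Diff_atLeastAtMost)
    moreover have "\<Sum>(?C B) = \<Sum>{1..m} - t" using sum_Diff_atLeastAtMost[OF p(2)] p(5) by simp
    ultimately have "\<Sum>(?C (lower a (?C B))) = Suc t"
      using l(5) Suc.prems by linarith
    then show ?case using l(2,3) p(1) by auto
  next
    case (5 p)
    then obtain A a where p: "p = (A, a)" "A \<subseteq> {1..m}" "a \<in> A" "a - 1 \<notin> A" by auto
    show ?case using lower_properties[OF p(2-4)] p(1) by simp
  qed
  also have "\<dots> = (\<Sum>B\<in>?S t. \<Sum>a\<in>?L (?C B). schur_count B * schur_count (lower a (?C B)))"
    using finS finL by (intro sum.Sigma[symmetric]) auto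
  also have "\<dots> = (\<Sum>B\<in>?S t. schur_count B * schur_count (?C B))"
  proof (intro sum.cong refl)
    fix B assume B: "B \<in> ?S t"
    \<comment> \<open>As \<open>t\<close> is smaller than \<open>\<Sum>{1..m}\<close>, the
      complement is not empty and the recursion applies to it.\<close>
    then have "\<Sum>(?C B) \<noteq> 0"
      using sum_Diff_atLeastAtMost[of B m] Suc.prems by (simp del: sum_eq_0_iff)
    then have "?C B \<noteq> {}" by (metis sum.empty)
    then have "schur_count (?C B) = (\<Sum>a\<in>?L (?C B). schur_count (lower a (?C B)))"
      by (intro schur_count_lower[of "?C B" m]) auto
    then show "(\<Sum>a\<in>?L (?C B). schur_count B * schur_count (lower a (?C B))) =
        schur_count B * schur_count (?C B)"
      by (simp only: sum_distrib_left)
  qed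
  also have "\<dots> = schur_count {1..m}" using Suc by simp
  finally show ?case .
qed

text \<open>Group the sets by their sum \<open>t\<close>: by \<open>sum_complementary\<close> each
  group contributes \<open>f t\<close> times the same constant.\<close>

lemma sum_complementary_weighted:
  "(\<Sum>A\<in>Pow {1..m}. f (\<Sum>A) * (schur_count A * schur_count ({1..m} - A))) =
    schur_count {1..m} * (\<Sum>t\<le>\<Sum>{1..m}. f t)"
proof -
  let ?h = "\<lambda>A. f (\<Sum>A) * (schur_count A * schur_count ({1..m} - A))"
  have "(\<Sum>A\<in>Pow {1..m}. ?h A) =
    (\<Sum>t\<le>\<Sum>{1..m}. \<Sum>A | A \<in> Pow {1..m} \<and> \<Sum>A = t. ?h A)"
    using sum_subset_le by (intro sum.group[symmetric]) auto
  also have "\<dots> = (\<Sum>t\<le>\<Sum>{1..m}. f t * schur_count {1..m})"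
  proof (intro sum.cong refl)
    fix t assume "t \<in> {..\<Sum>{1..m}}"
    then have "(\<Sum>A | A \<subseteq> {1..m} \<and> \<Sum>A = t. schur_count A * schur_count ({1..m} - A)) =
      schur_count {1..m}" by (intro sum_complementary) simp
    then show "(\<Sum>A | A \<in> Pow {1..m} \<and> \<Sum>A = t. ?h A) = f t * schur_count {1..m}"
      by (simp flip: sum_distrib_left)
  qed
  finally show ?thesis by (simp add: sum_distrib_left mult.commute)
qed

section \<open>Schur's formula for staircases\<close>

lemma prod_minus: "k < u \<Longrightarrow> (\<Prod>s=1..k. real u - real s) = fact (u - 1) / fact (u - 1 - k)"
proof (induction k)
  case (Suc k)
  have "u - 1 - k = Suc (u - 1 - Suc k)" using Suc.prems by simp
  then have "fact (u - 1 - k) = (real u - real (Suc k)) * fact (u - 1 - Suc k)"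
    using Suc.prems by (simp add: of_nat_diff)
  moreover have "(\<Prod>s=1..Suc k. real u - real s) =
      fact (u - 1) / fact (u - 1 - k) * (real u - real (Suc k))"
    using Suc by simp
  moreover have "real u - real (Suc k) \<noteq> 0" using Suc.prems by simp
  ultimately show ?case by (simp only: mult.commute) (simp del: of_nat_Suc)
qed simp

lemma prod_plus: "(\<Prod>s=1..k. real u + real s) = fact (u + k) / fact u"
proof (induction k)
  case (Suc k)
  have "(\<Prod>s=1..Suc k. real u + real s) = fact (u + k) / fact u * (real u + real (Suc k))"
    using Suc by simp
  moreover have "fact (u + Suc k) = fact (u + k) * (real u + real (Suc k))"
    by (simp add: algebra_simps)
  ultimately show ?case by (simp only: times_divide_eq_left)
qed simp

lemma prod_pair_factor:
  "k < u \<Longrightarrow> (\<Prod>s=1..k. pair_factor u s) =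
     (fact (u - 1) / fact (u - 1 - k)) * (fact u / fact (u + k))"
proof -
  assume k: "k < u"
  have "(\<Prod>s=1..k. pair_factor u s) = (\<Prod>s=1..k. (real u - real s) / (real u + real s))"
    using k by (intro prod.cong) (auto simp: pair_factor_def)
  also have "\<dots> = (\<Prod>s=1..k. real u - real s) / (\<Prod>s=1..k. real u + real s)"
    by (simp add: prod_dividef)
  finally show ?thesis unfolding prod_minus[OF k] prod_plus by simp
qed

lemma schur_count_staircase_Suc:
  "schur_count {1..Suc n} = schur_count {1..n} * fact (\<Sum>{1..Suc n}) / fact (\<Sum>{1..n}) *
     fact n / fact (2 * n + 1)"
proof -
  have "{1..Suc n} = insert (Suc n) {1..n}" by auto
  then have "schur_count {1..Suc n} = schur_count {1..n} * fact (\<Sum>{1..n} + Suc n) / fact (\<Sum>{1..n})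
     / fact (Suc n) * (\<Prod>a=1..n. pair_factor (Suc n) a)"
    using schur_count_insert[of "{1..n}" "Suc n"] by simp
  then show ?thesis unfolding prod_pair_factor[OF lessI] by (simp add: mult_2 add.commute del: fact_Suc)
qed

lemma sum_atLeastAtMost_choose: "\<Sum>{1..n} = (n + 1) choose 2"
  by (induction n) (auto simp: numeral_2_eq_2)

text \<open>Both sides obey the same recursion in \<open>n\<close>: the new pairs
  \<open>(i, n + 1)\<close> with \<open>0 \<le> i \<le> n\<close> bring the product
  \<open>fact (2 * n + 1) / fact n\<close> into the denominator.\<close>

lemma schur_count_staircase: "schur_count {1..n} = g_staircase n"
proof (induction n)
  case 0
  have "{(i, j). i < j \<and> j \<le> (0::nat)} = {}" by auto
  then have "(\<Prod>(i, j)\<in>{(i, j). i < j \<and> j \<le> (0::nat)}. real (i + j)) = 1"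
    by (simp only: prod.empty)
  then show ?case unfolding g_staircase_def by (simp only:) (simp add: numeral_2_eq_2)
next
  case (Suc n)
  let ?P = "\<lambda>n. {(i, j). i < j \<and> j \<le> (n::nat)}"
  have eq: "?P (Suc n) = ?P n \<union> (\<lambda>i. (i, Suc n)) ` {..n}" by (auto simp: le_Suc_eq)
  have "finite (?P n)" by (rule finite_subset[of _ "{..n} \<times> {..n}"]) auto
  then have "(\<Prod>(i, j)\<in>?P (Suc n). real (i + j)) =
      (\<Prod>(i, j)\<in>?P n. real (i + j)) * (\<Prod>(i, j)\<in>(\<lambda>i. (i, Suc n)) ` {..n}. real (i + j))"
    unfolding eq by (intro prod.union_disjoint) auto
  also have "(\<Prod>(i, j)\<in>(\<lambda>i. (i, Suc n)) ` {..n}. real (i + j)) = (\<Prod>i\<le>n. real (i + Suc n))"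
    by (subst prod.reindex) (auto simp: inj_on_def intro!: prod.cong)
  also have "\<dots> = fact (2 * n + 1) / fact n"
  proof -
    have "(\<Prod>i\<le>k. real (i + Suc n)) = fact (n + k + 1) / fact n" for k
    proof (induction k)
      case (Suc k)
      have "fact (n + Suc k + 1) = fact (n + k + 1) * real (Suc k + Suc n)"
        by (simp add: algebra_simps)
      moreover have "(\<Prod>i\<le>Suc k. real (i + Suc n)) = fact (n + k + 1) / fact n * real (Suc k + Suc n)"
        using Suc by simp
      ultimately show ?case by (simp only: times_divide_eq_left)
    qed (simp add: field_simps)
    from this[of n] show ?thesis by (simp only: mult_2)
  qed
  finally show ?case
    unfolding schur_count_staircase_Suc Suc sum_atLeastAtMost_choose by (simp add: g_staircase_def)
qed

section \<open>Diagrams of strict partitions\<close>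

text \<open>
  A strict partition is represented by its set of parts, where an element \<open>0\<close> has no effect;
  \<open>beyond A d\<close> is the number of boxes \<open>(i, i + d)\<close> in its diagram.
\<close>

definition beyond :: "nat set \<Rightarrow> nat \<Rightarrow> nat" where
  "beyond A d = card {a \<in> A. d < a}"

text \<open>Row \<open>i\<close> is as long as the \<open>i\<close>-th largest part, and this part
  exceeds \<open>c - i\<close> exactly if at least \<open>i\<close> parts do. Describing the diagram
  by its diagonals avoids sorting the parts.\<close>

definition boxes :: "nat set \<Rightarrow> (nat \<times> nat) set" where
  "boxes A = {(i, c). 1 \<le> i \<and> i \<le> c \<and> i \<le> beyond A (c - i)}"

lemma mem_boxes [simp]: "(i, c) \<in> boxes A \<longleftrightarrow> 1 \<le> i \<and> i \<le> c \<and> i \<le> beyond A (c - i)"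
  by (simp add: boxes_def)

lemma beyond_Suc:
  assumes "finite A"
  shows "beyond A d = beyond A (Suc d) + (if Suc d \<in> A then 1 else 0)"
proof (cases "Suc d \<in> A")
  case True
  then have "{a \<in> A. d < a} = insert (Suc d) {a \<in> A. Suc d < a}" by auto
  then show ?thesis using assms True by (simp add: beyond_def)
next
  case False
  then have "d < a \<longleftrightarrow> Suc d < a" if "a \<in> A" for a using that by (metis Suc_lessI less_Suc_eq Suc_lessD)
  then have "{a \<in> A. d < a} = {a \<in> A. Suc d < a}" by auto
  then show ?thesis using False by (simp add: beyond_def)
qed

lemma beyond_antimono: "finite A \<Longrightarrow> d \<le> d' \<Longrightarrow> beyond A d' \<le> beyond A d"
  unfolding beyond_def by (intro card_mono) auto

lemma beyond_le_add:
  assumes "finite A" "d \<le> d'"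
  shows "beyond A d \<le> beyond A d' + (d' - d)"
  using assms(2)
proof (induction d' rule: dec_induct)
  case (step d')
  then show ?case using beyond_Suc[OF assms(1), of d'] by (simp split: if_splits)
qed simp

lemma beyond_le: "A \<subseteq> {..n} \<Longrightarrow> beyond A d \<le> n - d"
proof -
  assume "A \<subseteq> {..n}"
  then have "card {a \<in> A. d < a} \<le> card {d<..n}" by (intro card_mono) auto
  then show ?thesis by (simp add: beyond_def)
qed

text \<open>A move up or to the left either does not lead away from the main diagonal, and then
  \<open>beyond\<close> does not decrease, or it leads away by at most \<open>i - i'\<close>
  diagonals. Each of these costs at most one box, which the smaller row index makes up for.\<close>

lemma boxes_down:
  assumes "finite A" "(i, c) \<in> boxes A" "1 \<le> i'" "i' \<le> i" "i' \<le> c'" "c' \<le> c"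
  shows "(i', c') \<in> boxes A"
proof (cases "c' - i' \<le> c - i")
  case True
  then show ?thesis using beyond_antimono[OF assms(1) True] assms by simp
next
  case False
  then have "beyond A (c - i) \<le> beyond A (c' - i') + ((c' - i') - (c - i))"
    using assms(1) by (intro beyond_le_add) auto
  moreover have "(c' - i') - (c - i) \<le> i - i'" using assms by auto
  moreover have "i \<le> beyond A (c - i)" using assms(2) by simp
  ultimately have "i' \<le> beyond A (c' - i')" using assms(4) by linarith
  then show ?thesis using assms by simp
qed

definition stair :: "nat \<Rightarrow> (nat \<times> nat) set" where
  "stair n = {(i, c). 1 \<le> i \<and> i \<le> c \<and> c \<le> n}"

lemma mem_stair [simp]: "(i, c) \<in> stair n \<longleftrightarrow> 1 \<le> i \<and> i \<le> c \<and> c \<le> n"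
  by (simp add: stair_def)

lemma finite_stair: "finite (stair n)"
  by (rule finite_subset[of _ "{..n} \<times> {..n}"]) (auto simp: stair_def)

lemma boxes_atLeastAtMost: "boxes {1..n} = stair n"
proof -
  have "{a \<in> {1..n}. d < a} = {d<..n}" for d by auto
  then have "beyond {1..n} d = n - d" for d unfolding beyond_def by simp
  then show ?thesis by (auto simp: boxes_def stair_def)
qed

lemma boxes_subset: "A \<subseteq> {..n} \<Longrightarrow> boxes A \<subseteq> stair n"
proof
  fix x assume "A \<subseteq> {..n}" "x \<in> boxes A"
  then show "x \<in> stair n"
    using beyond_le[of A n "snd x - fst x"] by (cases x) auto
qed

lemma finite_boxes: "finite A \<Longrightarrow> finite (boxes A)"
proof -
  assume "finite A"
  then obtain n where "A \<subseteq> {..n}" unfolding finite_nat_set_iff_bounded_le by blast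
  then have "boxes A \<subseteq> stair n" by (rule boxes_subset)
  then show ?thesis using finite_stair by (rule finite_subset)
qed

lemma beyond_Diff_0: "beyond (A - {0}) d = beyond A d"
  unfolding beyond_def by (rule arg_cong[of _ _ card]) auto

lemma boxes_Diff_0: "boxes (A - {0}) = boxes A"
  by (simp add: boxes_def beyond_Diff_0)

text \<open>The diagram determines the diagonal lengths \<open>beyond A d\<close>, and
  \<open>Suc d\<close> is a part exactly if the length drops from \<open>d\<close> to
  \<open>Suc d\<close>. A part 0 leaves no trace.\<close>

lemma boxes_inject:
  assumes "finite A" "finite B" "boxes A = boxes B"
  shows "A - {0} = B - {0}"
proof -
  have "i \<le> beyond A d \<longleftrightarrow> i \<le> beyond B d" if "1 \<le> i" for i d
    using assms(3) mem_boxes[of i "i + d" A] mem_boxes[of i "i + d" B] that by auto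
  then have "beyond A d = beyond B d" for d
    by (metis le_antisym le_refl not_less_eq_eq One_nat_def zero_le)
  then have "Suc d \<in> A \<longleftrightarrow> Suc d \<in> B" for d
    using beyond_Suc[OF assms(1), of d] beyond_Suc[OF assms(2), of d] by (simp split: if_splits)
  then show ?thesis by (auto simp: gr0_conv_Suc)
qed

section \<open>Corners of a diagram and Schur's theorem\<close>

text \<open>The last box of the row belonging to the part \<open>a\<close>: its row number counts
  the parts that are at least \<open>a\<close>, that is, exceed \<open>a - 1\<close>.\<close>

definition end_box :: "nat set \<Rightarrow> nat \<Rightarrow> nat \<times> nat" where
  "end_box A a = (beyond A (a - 1), beyond A (a - 1) + a - 1)"

text \<open>Replacing \<open>a\<close> by \<open>a - 1\<close> changes only the number of parts
  above \<open>a - 1\<close>, so only the diagonal \<open>a - 1\<close> loses a box, its last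
  one.\<close>

lemma boxes_lower:
  assumes "finite A" "a \<in> A" "1 \<le> a" "a - 1 \<notin> A"
  shows "boxes (insert (a - 1) (A - {a})) = boxes A - {end_box A a}"
    and "end_box A a \<in> boxes A"
proof -
  define B where "B = insert (a - 1) (A - {a})"
  have pos: "1 \<le> beyond A (a - 1)"
    using beyond_Suc[OF assms(1), of "a - 1"] assms by simp
  then show "end_box A a \<in> boxes A" using assms(3) by (simp add: end_box_def)
  have eq: "beyond B d = (if d = a - 1 then beyond A d - 1 else beyond A d)" for d
  proof (cases d "a - 1" rule: linorder_cases)
    case less
    then have "{x \<in> insert (a - 1) (A - {a}). d < x} = insert (a - 1) ({x \<in> A. d < x} - {a})" by auto
    moreover have "a \<in> {x \<in> A. d < x}" using less assms by auto
    ultimately show ?thesis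
      using less assms card_Suc_Diff1[of "{x \<in> A. d < x}" a] by (simp add: beyond_def B_def)
  next
    case equal
    then have "{x \<in> insert (a - 1) (A - {a}). d < x} = {x \<in> A. d < x} - {a}" by auto
    then show ?thesis using equal assms by (simp add: beyond_def B_def)
  next
    case greater
    then have "{x \<in> insert (a - 1) (A - {a}). d < x} = {x \<in> A. d < x}" by auto
    then show ?thesis using greater by (simp add: beyond_def B_def)
  qed
  show "boxes (insert (a - 1) (A - {a})) = boxes A - {end_box A a}"
    unfolding B_def[symmetric]
  proof (rule set_eqI)
    fix x :: "nat \<times> nat"
    obtain i c where x: "x = (i, c)" by (cases x)
    have "x = end_box A a \<longleftrightarrow> i = beyond A (a - 1) \<and> c - i = a - 1" if "i \<le> c"
      using that assms(3) by (auto simp: x end_box_def)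
    moreover have "i \<le> beyond B (c - i) \<longleftrightarrow>
        i \<le> beyond A (c - i) \<and> \<not> (i = beyond A (a - 1) \<and> c - i = a - 1)" if "1 \<le> i"
      using that pos eq[of "c - i"] by (cases "c - i = a - 1") auto
    ultimately show "x \<in> boxes B \<longleftrightarrow> x \<in> boxes A - {end_box A a}"
      unfolding x Diff_iff mem_boxes singleton_iff by metis
  qed
qed

text \<open>A box is maximal exactly if its neighbours to the right and below are missing. The first
  condition makes it the end of the row of a part \<open>a\<close>, the second says that
  \<open>a - 1\<close> is not a part.\<close>

lemma maximal_boxes:
  assumes "finite A" "0 \<notin> A"
  shows "{m \<in> boxes A. \<forall>x\<in>boxes A - {m}. \<not> before m x} = end_box A ` {a \<in> A. a - 1 \<notin> A}"
    (is "?M = ?E")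
proof
  show "?M \<subseteq> ?E"
  proof clarify
    fix i c assume m: "(i, c) \<in> boxes A" "\<forall>x\<in>boxes A - {(i, c)}. \<not> before (i, c) x"
    define d where "d = c - i"
    have "(i, Suc c) \<notin> boxes A" "(Suc i, c) \<notin> boxes A"
      using m(2)[rule_format, of "(i, Suc c)"] m(2)[rule_format, of "(Suc i, c)"]
      by (auto simp del: mem_boxes)
    with m(1) have i: "1 \<le> i" "i \<le> c" "i \<le> beyond A d" "\<not> i \<le> beyond A (Suc d)"
      "Suc i \<le> c \<Longrightarrow> \<not> Suc i \<le> beyond A (d - 1)"
      by (auto simp: d_def Suc_diff_le)
    have d1: "Suc d \<in> A" "i = beyond A d"
      using beyond_Suc[OF assms(1), of d] i by (auto split: if_splits)
    moreover have "d \<notin> A"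
    proof (cases d)
      case (Suc d')
      then have "Suc i \<le> c" by (simp add: d_def)
      with i(5) Suc d1(2) show ?thesis
        using beyond_Suc[OF assms(1), of d'] by (auto split: if_splits)
    qed (use assms in simp)
    moreover have "i + d = c" using i(2) by (simp add: d_def)
    then have "(i, c) = end_box A (Suc d)" using d1(2) by (auto simp: end_box_def)
    ultimately show "(i, c) \<in> ?E" by auto
  qed
next
  show "?E \<subseteq> ?M"
  proof (rule image_subsetI)
    fix a assume "a \<in> {a \<in> A. a - 1 \<notin> A}"
    then have a: "a \<in> A" "a - 1 \<notin> A" by auto
    then have "1 \<le> a" using assms by (cases a) auto
    define i where "i = beyond A (a - 1)"
    have eb: "end_box A a = (i, i + a - 1)" by (simp add: end_box_def i_def)
    have i: "i = beyond A a + 1" using beyond_Suc[OF assms(1), of "a - 1"] a \<open>1 \<le> a\<close> by (simp add: i_def)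
    have "\<not> before (i, i + a - 1) (i', c')" if x: "(i', c') \<in> boxes A" for i' c'
    proof
      assume "before (i, i + a - 1) (i', c')"
      \<comment> \<open>By \<open>boxes_down\<close>, a box further along the row or column forces
        the adjacent one into the diagram.\<close>
      then consider "i = i'" "i + a \<le> c'" | "c' = i + a - 1" "i + 1 \<le> i'" by fastforce
      then show False
      proof cases
        case 1
        have "(i, i + a) \<in> boxes A"
          by (rule boxes_down[OF assms(1) x]) (use 1 i in auto)
        then show False using i by simp
      next
        case 2
        have "(i + 1, i + a - 1) \<in> boxes A"
          by (rule boxes_down[OF assms(1) x]) (use 2 x in auto)
        then have *: "2 \<le> a" "i + 1 \<le> beyond A (a - 2)" by (auto simp: numeral_2_eq_2)
        moreover have "Suc (a - 2) = a - 1" using *(1) by simp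
        ultimately show False using beyond_Suc[OF assms(1), of "a - 2"] a by (simp add: i_def)
      qed
    qed
    then have "\<not> before (end_box A a) x" if "x \<in> boxes A" for x
      using that unfolding eb by (cases x) blast
    then show "end_box A a \<in> ?M"
      using boxes_lower(2)[OF assms(1) a(1) \<open>1 \<le> a\<close> a(2)] by blast
  qed
qed

text \<open>Schur's theorem. The last box of a linear extension is a corner, and removing it lowers
  a part, so the count obeys the recursion \<open>schur_count_rec\<close>. The induction is on the
  number \<open>\<Sum>A\<close> of boxes.\<close>

lemma card_linear_exts_boxes:
  assumes "finite A"
  shows "real (card (linear_exts before (boxes A))) = schur_count A"
proof -
  have *: "real (card (linear_exts before (boxes A))) = schur_count A" if "finite A" "0 \<notin> A" for A
    using that
  proof (induction "\<Sum>A" arbitrary: A rule: less_induct)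
    case less
    show ?case
    proof (cases "A = {}")
      case True
      then have "boxes A = {}" by (auto simp: boxes_def beyond_def)
      then show ?thesis using True by (simp add: linear_exts_empty)
    next
      case False
      let ?L = "{a. a \<in> A \<and> a - 1 \<notin> A}"
      let ?A = "\<lambda>a. insert (a - 1) (A - {a})"
      have rec: "real (card (linear_exts before (boxes A - {end_box A a}))) = schur_count (?A a)"
        if a: "a \<in> ?L" for a
      proof -
        have "1 \<le> a" using a less.prems by (cases a) auto
        have "\<Sum>(?A a - {0}) \<le> \<Sum>(?A a)" using less.prems by (intro sum_mono2) auto
        also have "\<dots> = a - 1 + \<Sum>(A - {a})" using a less.prems by simp
        also have "\<dots> < a + \<Sum>(A - {a})" using \<open>1 \<le> a\<close> by simp
        also have "\<dots> = \<Sum>A" using sum.remove[of A a "\<lambda>x. x"] a less.prems by simp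
        finally have "real (card (linear_exts before (boxes (?A a - {0})))) = schur_count (?A a - {0})"
          using less.prems by (intro less.hyps) auto
        then show ?thesis
          using a less.prems \<open>1 \<le> a\<close> boxes_lower(1)[of A a]
          by (simp add: boxes_Diff_0 schur_count_Diff_0)
      qed
      have inj: "inj_on (end_box A) ?L"
      proof (rule inj_onI)
        fix a b assume "a \<in> ?L" "b \<in> ?L" "end_box A a = end_box A b"
        moreover from this have "1 \<le> a" "1 \<le> b" using less.prems by (auto intro!: Suc_leI Nat.gr0I)
        ultimately show "a = b" by (auto simp: end_box_def)
      qed
      \<comment> \<open>The smallest part can always be lowered, so the diagram has a
        corner.\<close>
      obtain a where "a \<in> A" "a - 1 \<notin> A"
      proof
        show "Min A \<in> A" using False less.prems by simp
        then have "Min A \<noteq> 0" using less.prems by metis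
        show "Min A - 1 \<notin> A"
        proof
          assume "Min A - 1 \<in> A"
          then have "Min A \<le> Min A - 1" using less.prems by simp
          then show False using \<open>Min A \<noteq> 0\<close> by simp
        qed
      qed
      then have "boxes A \<noteq> {}" using maximal_boxes[OF less.prems] by blast
      then have "card (linear_exts before (boxes A)) =
          (\<Sum>m\<in>end_box A ` ?L. card (linear_exts before (boxes A - {m})))"
        using card_linear_exts_last[of "boxes A" before] finite_boxes maximal_boxes less.prems by simp
      also have "\<dots> = (\<Sum>a\<in>?L. card (linear_exts before (boxes A - {end_box A a})))"
        using inj by (simp add: sum.reindex)
      finally show ?thesis using rec schur_count_rec[of A] less.prems False by simp
    qed
  qed
  show ?thesis using *[of "A - {0}"] assms by (simp add: boxes_Diff_0 schur_count_Diff_0)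
qed

text \<open>Reflecting the staircase in its antidiagonal reverses the order.\<close>

lemma card_linear_exts_complement:
  assumes "B \<subseteq> {..n}"
  shows "card (linear_exts before (stair n - boxes B)) =
    card (linear_exts before (boxes ({1..n} - B)))"
proof -
  define f where "f = (\<lambda>(i, c). (n + 1 - c, n + 1 - i))"
  define K where "K = {1..n} - B"
  have C: "boxes K \<subseteq> stair n" by (rule boxes_subset) (auto simp: K_def)
  have ff: "f (f x) = x" if "x \<in> stair n" for x
    using that by (cases x) (auto simp: f_def)
  have fS: "f x \<in> stair n" if "x \<in> stair n" for x
    using that by (cases x) (auto simp: f_def)
  have fin: "finite B" using assms finite_subset by blast
  have beyond: "beyond K d = n - d - beyond B d" for d
  proof -
    have "{a \<in> K. d < a} = {d<..n} - {b \<in> B. d < b}" by (auto simp: K_def)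
    moreover have "card ({d<..n} - {b \<in> B. d < b}) = card {d<..n} - card {b \<in> B. d < b}"
      using assms fin by (intro card_Diff_subset) auto
    ultimately show ?thesis by (simp add: beyond_def)
  qed
  \<comment> \<open>\<open>f\<close> preserves \<open>c - i\<close> and reverses each diagonal. The
    diagonal \<open>d\<close> of the staircase has \<open>n - d\<close> boxes, of which
    \<open>boxes B\<close> takes the first \<open>beyond B d\<close>; the others, reversed, form an
    initial segment of length \<open>beyond K d\<close>.\<close>
  have iff: "f x \<in> boxes K \<longleftrightarrow> x \<notin> boxes B" if x: "x \<in> stair n" for x
  proof -
    obtain i c where ic: "x = (i, c)" "1 \<le> i" "i \<le> c" "c \<le> n"
      using x by (cases x) auto
    have "n + 1 - i - (n + 1 - c) = c - i" using ic by simp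
    moreover have "beyond B (c - i) \<le> n - (c - i)" using assms by (rule beyond_le)
    ultimately show ?thesis using ic by (auto simp: f_def beyond)
  qed
  have "stair n - boxes B = f ` boxes K"
  proof
    show "stair n - boxes B \<subseteq> f ` boxes K"
    proof
      fix x assume "x \<in> stair n - boxes B"
      then show "x \<in> f ` boxes K"
        using iff[of x] ff[of x] by (intro image_eqI[of _ _ "f x"]) auto
    qed
    show "f ` boxes K \<subseteq> stair n - boxes B"
    proof (rule image_subsetI)
      fix x assume x: "x \<in> boxes K"
      then show "f x \<in> stair n - boxes B"
        using C ff[of x] fS[of x] iff[of "f x"] by auto
    qed
  qed
  moreover have "card (linear_exts before (f ` boxes K)) = card (linear_exts before (boxes K))"
  proof (rule card_linear_exts_dual)
    show "inj_on f (boxes K)" using C ff by (metis inj_onI subsetD)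
    fix x y assume "x \<in> boxes K" "y \<in> boxes K"
    then have "x \<in> stair n" "y \<in> stair n" using C by auto
    then show "before (f y) (f x) \<longleftrightarrow> before x y"
      by (cases x, cases y) (auto simp: f_def)
  qed
  ultimately show ?thesis by (simp add: K_def)
qed

section \<open>Order ideals of the staircase\<close>

lemma initial_segment:
  assumes "finite S" "0 \<notin> S" "\<And>i. Suc i \<in> S \<Longrightarrow> 1 \<le> i \<Longrightarrow> i \<in> S"
  shows "S = {1..card S}"
proof (cases "S = {}")
  case False
  have "i \<in> S" if "1 \<le> i" "i \<le> Max S" for i
    using that(2,1)
  proof (induction i rule: inc_induct)
    case base
    show ?case using False assms by simp
  qed (use assms in auto)
  moreover have "1 \<le> i" if "i \<in> S" for i using that assms(2) by (cases i) auto
  moreover have "i \<le> Max S" if "i \<in> S" for i using that assms(1) by simp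
  ultimately have S: "S = {1..Max S}"
    by (intro set_eqI iffI) (simp_all only: atLeastAtMost_iff)
  have "card S = Max S" using arg_cong[OF S, of card] by simp
  then show ?thesis using S by (simp only:)
qed simp

text \<open>An ideal meets the diagonal \<open>d\<close> in an initial segment of length
  \<open>k d\<close>, and from one diagonal to the next this length falls by 0 or 1. The parts are
  the places where it falls.\<close>

lemma ideal_boxes:
  assumes "I \<subseteq> stair n"
    and down: "\<And>x y. x \<in> I \<Longrightarrow> y \<in> stair n \<Longrightarrow> before y x \<Longrightarrow> y \<in> I"
  obtains A where "A \<subseteq> {1..n}" "I = boxes A"
proof -
  have I: "1 \<le> i \<and> i \<le> c \<and> c \<le> n" if "(i, c) \<in> I" for i c
    using subsetD[OF assms(1) that] by simp
  have left: "(i, c) \<in> I" if "(i, Suc c) \<in> I" "i \<le> c" for i c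
    using down[OF that(1), of "(i, c)"] I[OF that(1)] that(2) by auto
  have up: "(i, c) \<in> I" if "(Suc i, c) \<in> I" "1 \<le> i" for i c
    using down[OF that(1), of "(i, c)"] I[OF that(1)] that(2) by auto
  define D where "D = (\<lambda>d. {i. (i, i + d) \<in> I})"
  define k where "k = (\<lambda>d. card (D d))"
  have D: "D d = {1..k d}" for d
    unfolding k_def
  proof (rule initial_segment)
    show "finite (D d)" by (rule finite_subset[of _ "{..n}"]) (auto simp: D_def dest: I)
    show "0 \<notin> D d" by (auto simp: D_def dest: I)
    \<comment> \<open>The preceding box on the diagonal is reached by one step up and one step to
      the left.\<close>
    show "i \<in> D d" if "Suc i \<in> D d" "1 \<le> i" for i
      using left[OF up[of i "Suc (i + d)"]] that by (auto simp: D_def)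
  qed
  have mem: "(i, i + d) \<in> I \<longleftrightarrow> 1 \<le> i \<and> i \<le> k d" for i d
    using D[of d] by (auto simp: D_def)
  have k0: "k d = 0" if "n \<le> d" for d
    using mem[of 1 d] I[of 1 "1 + d"] that by auto
  have kS: "k (Suc d) \<le> k d" for d
    using mem[of "k (Suc d)" "Suc d"] mem[of "k (Suc d)" d] left[of "k (Suc d)" "k (Suc d) + d"]
    by (cases "k (Suc d) = 0") auto
  \<comment> \<open>One step up from the last box of the diagonal \<open>d\<close> leads to row
    \<open>k d - 1\<close> of the next diagonal.\<close>
  have kS': "k d \<le> k (Suc d) + 1" for d
  proof (cases "k d \<le> 1")
    case False
    define i where "i = k d - 1"
    have i: "k d = Suc i" "1 \<le> i" using False by (auto simp: i_def)
    have "(Suc i, Suc i + d) \<in> I" using mem[of "Suc i" d] i by simp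
    then have "(i, i + Suc d) \<in> I" using up[of i "Suc i + d"] i by simp
    then show ?thesis using mem[of i "Suc d"] i by simp
  qed simp
  define A where "A = {a. 1 \<le> a \<and> k a < k (a - 1)}"
  have A: "A \<subseteq> {1..n}"
  proof
    fix a assume "a \<in> A"
    then have "1 \<le> a" "k (a - 1) \<noteq> 0" by (auto simp: A_def)
    then show "a \<in> {1..n}" using k0[of "a - 1"] by (cases "n \<le> a - 1") auto
  qed
  have fin: "finite A" using A finite_subset by blast
  have beyond: "beyond A d = k d" for d
  proof (cases "d \<le> n")
    case True
    then show ?thesis
    proof (induction d rule: inc_induct)
      case base
      have "A \<subseteq> {..n}" using A by auto
      then show ?case using k0[of n] beyond_le[of A n n] by simp
    next
      case (step d)
      have "Suc d \<in> A \<longleftrightarrow> k (Suc d) < k d" by (simp add: A_def)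
      then show ?case using beyond_Suc[OF fin, of d] step kS[of d] kS'[of d] by auto
    qed
  next
    case False
    have "A \<subseteq> {..n}" using A by auto
    then show ?thesis using False k0[of d] beyond_le[of A n d] by simp
  qed
  have "I = boxes A"
  proof (rule set_eqI)
    fix x :: "nat \<times> nat"
    obtain i c where x: "x = (i, c)" by (cases x)
    show "x \<in> I \<longleftrightarrow> x \<in> boxes A"
      unfolding x using mem[of i "c - i"] I[of i c] by (cases "i \<le> c") (auto simp: beyond)
  qed
  with A that show ?thesis by blast
qed

text \<open>The cut is made at \<open>(2, n - 1)\<close>. An admissible ideal contains
  \<open>(1, n - 1)\<close> and, if \<open>n > 3\<close>, also \<open>(2, n - 2)\<close>, but
  neither \<open>(1, n)\<close> nor \<open>(2, n - 1)\<close>. This makes \<open>n - 1\<close> and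
  \<open>n - 3\<close> the two largest parts and leaves the others free. For \<open>n = 3\<close>
  the inserted \<open>n - 3\<close> is 0 and adds no box.\<close>

lemma card_linear_exts_truncated:
  assumes "n \<ge> 3"
  defines "P \<equiv> \<lambda>S. insert (n - 1) (insert (n - 3) S)"
  shows "card (linear_exts before (stair n - {(1, n)})) =
    (\<Sum>S\<in>Pow {1..n - 4}. card (linear_exts before (boxes (P S))) *
      card (linear_exts before (boxes (P ({1..n - 4} - S)))))"
proof -
  let ?D = "stair n - {(1, n)}"
  let ?c = "(2, n - 1)"
  let ?J = "{I. I \<subseteq> ?D - {?c} \<and> (\<forall>x\<in>I. \<forall>y\<in>?D. before y x \<longrightarrow> y \<in> I) \<and>
      (\<forall>y\<in>?D. before y ?c \<longrightarrow> y \<in> I)}"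
  have Pn: "P S \<subseteq> {..n}" if "S \<subseteq> {1..n - 4}" for S
    using that by (fastforce simp: P_def)
  then have finP: "finite (P S)" if "S \<subseteq> {1..n - 4}" for S
    using that finite_subset by blast
  \<comment> \<open>The boxes \<open>(1, n)\<close>, \<open>(1, n - 1)\<close> and
    \<open>(2, n - 1)\<close> lie on the diagonals \<open>n - 1\<close>, \<open>n - 2\<close> and
    \<open>n - 3\<close>, whose lengths decide whether they belong to the diagram.\<close>
  have bP: "beyond (P S) (n - 1) = 0" "beyond (P S) (n - 2) = 1" "beyond (P S) (n - 3) = 1"
    "d < n - 3 \<Longrightarrow> 2 \<le> beyond (P S) d" if S: "S \<subseteq> {1..n - 4}" for S d
  proof -
    have le: "a + 4 \<le> n" if "a \<in> S" for a using S that by fastforce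
    have "{a \<in> P S. n - 1 < a} = {}" "{a \<in> P S. n - 2 < a} = {n - 1}" "{a \<in> P S. n - 3 < a} = {n - 1}"
      using assms(1) by (auto simp: P_def dest: le)
    then show "beyond (P S) (n - 1) = 0" "beyond (P S) (n - 2) = 1" "beyond (P S) (n - 3) = 1"
      by (simp_all only: beyond_def) simp_all
    assume d: "d < n - 3"
    then have "card {n - 1, n - 3} \<le> card {a \<in> P S. d < a}"
      using finP[OF S] by (intro card_mono) (auto simp: P_def)
    then show "2 \<le> beyond (P S) d" using assms(1) by (simp add: beyond_def)
  qed
  have J: "?J = (\<lambda>S. boxes (P S)) ` Pow {1..n - 4}"
  proof
    show "(\<lambda>S. boxes (P S)) ` Pow {1..n - 4} \<subseteq> ?J"
    proof (rule image_subsetI)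
      fix S assume "S \<in> Pow {1..n - 4}"
      then have S: "S \<subseteq> {1..n - 4}" by simp
      note b = bP[OF S]
      have "(1, n) \<notin> boxes (P S)" using b(1) by simp
      moreover have "?c \<notin> boxes (P S)" using b(3) by (simp add: numeral_3_eq_3)
      ultimately have "boxes (P S) \<subseteq> ?D - {?c}" using boxes_subset[OF Pn[OF S]] by blast
      moreover have "y \<in> boxes (P S)" if "x \<in> boxes (P S)" "y \<in> ?D" "before y x" for x y
      proof -
        obtain i c i' c' where xy: "x = (i, c)" "y = (i', c')" by (cases x, cases y)
        show ?thesis
          unfolding xy by (rule boxes_down[OF finP[OF S] that(1)[unfolded xy]])
            (use that(2,3) in \<open>auto simp: xy\<close>)
      qed
      moreover have "y \<in> boxes (P S)" if y: "y \<in> ?D" "before y ?c" for y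
      proof -
        obtain i c where ic: "y = (i, c)" "1 \<le> i" "i \<le> c"
          using y(1) by (cases y) auto
        consider "i = 2" "c < n - 1" | "c = n - 1" "i = 1" using y ic by auto
        then show ?thesis
        proof cases
          case 1
          then have "c - 2 < n - 3" using ic by auto
          from b(4)[OF this] 1 ic show ?thesis by simp
        next
          case 2
          then show ?thesis using b(2) ic assms(1) by (simp add: numeral_2_eq_2)
        qed
      qed
      ultimately show "boxes (P S) \<in> ?J" by blast
    qed
  next
    show "?J \<subseteq> (\<lambda>S. boxes (P S)) ` Pow {1..n - 4}"
    proof
      fix I assume I: "I \<in> ?J"
      then have sub: "I \<subseteq> ?D - {?c}" and down: "\<And>x y. x \<in> I \<Longrightarrow> y \<in> ?D \<Longrightarrow> before y x \<Longrightarrow> y \<in> I"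
        and c: "\<And>y. y \<in> ?D \<Longrightarrow> before y ?c \<Longrightarrow> y \<in> I"
        by blast+
      have "?c \<notin> I" "(1, n) \<notin> I" using sub by auto
      have n2: "(2, n) \<notin> I"
      proof
        assume "(2, n) \<in> I"
        then have "?c \<in> I" using assms(1) by (intro down[of "(2, n)" ?c]) auto
        with \<open>?c \<notin> I\<close> show False ..
      qed
      have "I \<subseteq> stair n" using sub by auto
      \<comment> \<open>Downward closure extends to the full staircase: only a box of
        \<open>I\<close> in column \<open>n\<close> could require \<open>(1, n)\<close>, and such a
        box would force \<open>(2, n)\<close> into \<open>I\<close>.\<close>
      moreover have "y \<in> I" if xy: "x \<in> I" "y \<in> stair n" "before y x" for x y
      proof (cases "y = (1, n)")
        case True
        have "x \<in> stair n" using that sub by auto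
        then obtain i where x: "x = (i, n)" "2 \<le> i"
          using xy True by (cases x) auto
        have "i \<noteq> 2" using x that n2 by auto
        then have "(2, n) \<in> I"
          using that(1) x down[of "(i, n)" "(2, n)"] assms(1) by auto
        with n2 show ?thesis by simp
      next
        case False
        then show ?thesis using that down[of x y] by auto
      qed
      ultimately obtain A where A: "A \<subseteq> {1..n}" "I = boxes A" by (rule ideal_boxes)
      have finA: "finite A" and An: "A \<subseteq> {..n}" using A finite_subset by auto
      have "Suc (n - 1) = n" "Suc (n - 2) = n - 1" "Suc (n - 3) = n - 2"
        using assms(1) by simp_all
      \<comment> \<open>No part exceeds \<open>n\<close>, so the outermost diagonals reveal one
        after another whether \<open>n\<close>, \<open>n - 1\<close> and \<open>n - 2\<close> are
        parts.\<close>
      then have b: "beyond A (n - 1) = (if n \<in> A then 1 else 0)"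
        "beyond A (n - 2) = beyond A (n - 1) + (if n - 1 \<in> A then 1 else 0)"
        "beyond A (n - 3) = beyond A (n - 2) + (if n - 2 \<in> A then 1 else 0)"
        using beyond_Suc[OF finA, of "n - 1"] beyond_Suc[OF finA, of "n - 2"]
          beyond_Suc[OF finA, of "n - 3"] beyond_le[OF An, of n] by simp_all
      have "n \<notin> A" using \<open>(1, n) \<notin> I\<close> A(2) b(1) assms(1) by auto
      have "(1, n - 1) \<in> I"
        by (rule c) (use assms(1) in auto)
      then have "n - 1 \<in> A"
        using A(2) b(1,2) \<open>n \<notin> A\<close> by (auto simp: numeral_2_eq_2 split: if_splits)
      have "n - 2 \<notin> A"
        using \<open>?c \<notin> I\<close> A(2) b assms(1) \<open>n - 1 \<in> A\<close> by (auto simp: numeral_3_eq_3 numeral_2_eq_2)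
      have b1: "beyond A (n - 3) = 1"
        using b \<open>n \<notin> A\<close> \<open>n - 1 \<in> A\<close> \<open>n - 2 \<notin> A\<close> by simp
      have n3: "n - 3 \<in> A" if "4 \<le> n"
      proof -
        have "(2, n - 2) \<in> I"
          by (rule c) (use that in auto)
        then have "2 \<le> beyond A (n - 4)" using A(2) by simp
        moreover have "Suc (n - 4) = n - 3" using that by simp
        ultimately show ?thesis
          using b1 beyond_Suc[OF finA, of "n - 4"] by (auto split: if_splits)
      qed
      have "A = P (A \<inter> {1..n - 4}) - {0}"
      proof (rule set_eqI)
        fix a
        show "a \<in> A \<longleftrightarrow> a \<in> P (A \<inter> {1..n - 4}) - {0}"
        proof (cases "a = 0 \<or> a = n \<or> a = n - 1 \<or> a = n - 2 \<or> a = n - 3")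
          case True
          then show ?thesis
            using A(1) \<open>n \<notin> A\<close> \<open>n - 1 \<in> A\<close> \<open>n - 2 \<notin> A\<close> n3 assms(1)
            by (cases "n = 3") (auto simp: P_def)
        next
          case False
          have "a \<in> A \<Longrightarrow> a \<le> n" using A(1) by auto
          then show ?thesis using False by (auto simp: P_def)
        qed
      qed
      then have "I = boxes (P (A \<inter> {1..n - 4}))" using A(2) boxes_Diff_0 by metis
      then show "I \<in> (\<lambda>S. boxes (P S)) ` Pow {1..n - 4}" by blast
    qed
  qed
  have inj: "inj_on (\<lambda>S. boxes (P S)) (Pow {1..n - 4})"
  proof (rule inj_onI)
    fix S S' assume S: "S \<in> Pow {1..n - 4}" "S' \<in> Pow {1..n - 4}" "boxes (P S) = boxes (P S')"
    then have "P S - {0} = P S' - {0}" using boxes_inject finP by auto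
    moreover have "S = (P S - {0}) \<inter> {1..n - 4}" if "S \<in> Pow {1..n - 4}" for S
      using that by (auto simp: P_def)
    ultimately show "S = S'" using S by metis
  qed
  \<comment> \<open>Adding \<open>(1, n)\<close> and \<open>?c\<close> to \<open>boxes (P S)\<close>
    raises the parts \<open>n - 1\<close> and \<open>n - 3\<close> to \<open>n\<close> and
    \<open>n - 2\<close>, which gives \<open>?B\<close>. The rest of the staircase, turned around,
    has the parts missing from \<open>?B\<close>: again \<open>n - 1\<close>, \<open>n - 3\<close>
    and the complement of \<open>S\<close>.\<close>
  have upper: "card (linear_exts before (?D - boxes (P S) - {?c})) =
      card (linear_exts before (boxes (P ({1..n - 4} - S))))" if S: "S \<subseteq> {1..n - 4}" for S
  proof -
    have fin: "finite S" using S finite_subset by blast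
    have le: "a + 4 \<le> n" if "a \<in> S" for a using S that by fastforce
    have nin: "n \<notin> S" "n - 1 \<notin> S" "n - 2 \<notin> S" "n - 3 \<notin> S"
      using assms(1) by (auto dest: le)
    let ?B = "insert n (insert (n - 2) S)"
    let ?B' = "insert (n - 1) (insert (n - 2) S)"
    have Bn: "?B \<subseteq> {..n}" by (auto dest: le)
    have "{a \<in> ?B. n - 1 < a} = {n}" "{a \<in> ?B'. n - 3 < a} = {n - 1, n - 2}"
      using assms(1) by (auto dest: le)
    then have bB: "beyond ?B (n - 1) = 1" "beyond ?B' (n - 3) = 2"
      using assms(1) by (simp_all add: beyond_def)
    have "insert (n - 1) (?B - {n}) = ?B'" using nin assms(1) by auto
    moreover have "boxes (insert (n - 1) (?B - {n})) = boxes ?B - {end_box ?B n}"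
      by (rule boxes_lower) (use fin nin assms(1) in auto)
    moreover have "end_box ?B n = (1, n)" unfolding end_box_def bB by simp
    ultimately have 1: "boxes ?B' = boxes ?B - {(1, n)}" by (simp only:)
    have m1: "(1, n) \<in> boxes ?B" using bB assms(1) by simp
    have n3: "n - 2 - 1 = n - 3" by simp
    have "insert (n - 3) (?B' - {n - 2}) = P S" using nin assms(1) by (auto simp: P_def)
    moreover have "boxes (insert (n - 2 - 1) (?B' - {n - 2})) = boxes ?B' - {end_box ?B' (n - 2)}"
      by (rule boxes_lower) (use fin nin assms(1) in auto)
    moreover have "end_box ?B' (n - 2) = ?c"
      unfolding end_box_def n3 bB using assms(1) by simp
    ultimately have 2: "boxes (P S) = boxes ?B' - {?c}" by (simp only: n3)
    have m2: "?c \<in> boxes ?B'" using bB(2) assms(1) by (simp add: numeral_3_eq_3)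
    have "?D - boxes (P S) - {?c} = stair n - boxes ?B"
      using 1 m1 2 m2 by blast
    then have "card (linear_exts before (?D - boxes (P S) - {?c})) =
        card (linear_exts before (boxes ({1..n} - ?B)))"
      using card_linear_exts_complement[OF Bn] by simp
    also have "{1..n} - ?B = P ({1..n - 4} - S) - {0}"
    proof (rule set_eqI)
      fix a
      obtain k where k: "n = k + 3" using assms(1) le_Suc_ex by (metis add.commute)
      show "a \<in> {1..n} - ?B \<longleftrightarrow> a \<in> P ({1..n - 4} - S) - {0}"
      proof (cases "a \<in> S")
        case True
        then show ?thesis using le[OF True] by (auto simp: P_def)
      next
        case False
        have "1 \<le> a \<and> a \<le> k + 3 \<and> a \<noteq> k + 3 \<and> a \<noteq> k + 1 \<longleftrightarrow>
            (a = k + 2 \<or> a = k \<or> 1 \<le> a \<and> a \<le> k - 1) \<and> a \<noteq> 0"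
          by linarith
        then show ?thesis using False by (simp add: P_def k)
      qed
    qed
    finally show ?thesis by (simp only: boxes_Diff_0)
  qed
  have "finite ?D" by (simp add: finite_stair)
  moreover have "?c \<in> ?D" using assms(1) by auto
  ultimately have "card (linear_exts before ?D) =
      (\<Sum>I\<in>?J. card (linear_exts before I) * card (linear_exts before (?D - I - {?c})))"
    by (rule card_linear_exts_split) simp
  also have "\<dots> = (\<Sum>S\<in>Pow {1..n - 4}. card (linear_exts before (boxes (P S))) *
      card (linear_exts before (?D - boxes (P S) - {?c})))"
    unfolding J using inj by (simp add: sum.reindex)
  also have "\<dots> = (\<Sum>S\<in>Pow {1..n - 4}. card (linear_exts before (boxes (P S))) *
      card (linear_exts before (boxes (P ({1..n - 4} - S)))))"
    by (intro sum.cong refl) (simp only: upper Pow_iff)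
  finally show ?thesis .
qed

section \<open>Evaluation of the sum\<close>

text \<open>This isolates the dependence on \<open>S\<close>: it enters through
  \<open>schur_count S\<close>, through \<open>\<Sum>S\<close>, and through a product over
  \<open>S\<close> that combines with the one over the complement to a constant.\<close>

lemma schur_count_insert2:
  assumes "S \<subseteq> {1..m}" "m < u" "v < u" "m < v \<or> v = 0"
  shows "schur_count (insert u (insert v S)) =
    schur_count S * (fact (\<Sum>S + (u + v)) / fact (\<Sum>S)) * (pair_factor u v / (fact u * fact v)) *
      (\<Prod>s\<in>S. pair_factor u s * pair_factor v s)"
proof -
  have fin: "finite S" using assms finite_subset by blast
  have "v \<notin> S" using assms by auto
  have "u \<notin> insert v S"
    using assms by auto
  have "schur_count (insert u (insert v S)) = schur_count (insert v S) *
      fact (\<Sum>S + v + u) / fact (\<Sum>S + v) / fact u * (pair_factor u v * (\<Prod>s\<in>S. pair_factor u s))"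
    using schur_count_insert[of "insert v S" u] fin \<open>v \<notin> S\<close> \<open>u \<notin> insert v S\<close>
    by (simp add: add_ac)
  also have "schur_count (insert v S) =
      schur_count S * fact (\<Sum>S + v) / fact (\<Sum>S) / fact v * (\<Prod>s\<in>S. pair_factor v s)"
    using fin \<open>v \<notin> S\<close> by (rule schur_count_insert)
  finally show ?thesis by (simp add: prod.distrib ac_simps)
qed

lemma catalan_fact: "catalan m = fact (2 * m) / (fact m * fact (m + 1))"
proof -
  have "real ((2 * m) choose m) = fact (2 * m) / (fact m * fact m)"
    using binomial_fact[of m "2 * m", where 'a = real] by (simp add: mult_2)
  then show ?thesis by (simp add: catalan_def add.commute)
qed

text \<open>In the product of the two formulas the weight \<open>f\<close> depends only on
  \<open>\<Sum>S\<close>, so \<open>sum_complementary_weighted\<close> leaves a sum over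
  \<open>t\<close>. Each quotient of factorials in \<open>f\<close> is \<open>fact p\<close> times a
  binomial coefficient, which makes this sum a Vandermonde convolution.\<close>

lemma sum_schur_count_product:
  assumes "m < u" "v < u" "m < v \<or> v = 0"
  defines "p \<equiv> u + v" and "M \<equiv> \<Sum>{1..m}"
  shows "(\<Sum>S\<in>Pow {1..m}. schur_count (insert u (insert v S)) *
      schur_count (insert u (insert v ({1..m} - S)))) =
    (pair_factor u v / (fact u * fact v))\<^sup>2 * (\<Prod>s=1..m. pair_factor u s * pair_factor v s) *
      schur_count {1..m} * (fact p)\<^sup>2 * real ((M + 2 * p + 1) choose (2 * p + 1))"
proof -
  let ?c = "pair_factor u v / (fact u * fact v)"
  let ?q = "\<lambda>S. \<Prod>s\<in>S. pair_factor u s * pair_factor v s"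
  define f :: "nat \<Rightarrow> real" where "f = (\<lambda>t. (fact (t + p) / fact t) * (fact (M - t + p) / fact (M - t)))"
  have "schur_count (insert u (insert v S)) * schur_count (insert u (insert v ({1..m} - S))) =
     ?c\<^sup>2 * ?q {1..m} * (f (\<Sum>S) * (schur_count S * schur_count ({1..m} - S)))"
    if "S \<in> Pow {1..m}" for S
  proof -
    have S: "S \<subseteq> {1..m}" using that by simp
    have "?q {1..m} = ?q ({1..m} - S) * ?q S" using S by (intro prod.subset_diff) auto
    moreover have "\<Sum>({1..m} - S) = M - \<Sum>S" using sum_Diff_atLeastAtMost[OF S] by (simp add: M_def)
    ultimately show ?thesis
      using schur_count_insert2[OF S assms(1-3)] schur_count_insert2[OF Diff_subset assms(1-3), of S]
      by (simp add: f_def p_def power2_eq_square ac_simps)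
  qed
  then have "(\<Sum>S\<in>Pow {1..m}. schur_count (insert u (insert v S)) *
      schur_count (insert u (insert v ({1..m} - S)))) =
      ?c\<^sup>2 * ?q {1..m} * (\<Sum>S\<in>Pow {1..m}. f (\<Sum>S) * (schur_count S * schur_count ({1..m} - S)))"
    unfolding sum_distrib_left by (intro sum.cong refl)
  also have "(\<Sum>S\<in>Pow {1..m}. f (\<Sum>S) * (schur_count S * schur_count ({1..m} - S))) =
      schur_count {1..m} * (\<Sum>t\<le>M. f t)"
    unfolding M_def by (rule sum_complementary_weighted)
  also have "(\<Sum>t\<le>M. f t) = (\<Sum>t\<le>M. (fact p)\<^sup>2 * real (((t + p) choose p) * ((M - t + p) choose p)))"
  proof (intro sum.cong refl)
    fix t
    have "fact (k + p) / fact k = fact p * real ((k + p) choose p)" for k :: nat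
      using binomial_fact[of p "k + p", where 'a = real] by simp
    then show "f t = (fact p)\<^sup>2 * real (((t + p) choose p) * ((M - t + p) choose p))"
      unfolding f_def by (simp add: power2_eq_square)
  qed
  also have "\<dots> = (fact p)\<^sup>2 * real ((M + 2 * p + 1) choose (2 * p + 1))"
    using sum_choose_mult_choose[of p M p]
    by (simp flip: sum_distrib_left of_nat_sum of_nat_mult add: mult_2 add.assoc)
  finally show ?thesis by simp
qed

lemma schur_count_staircase_add:
  "schur_count {1..k + j} = schur_count {1..k} * fact (\<Sum>{1..k + j}) / fact (\<Sum>{1..k}) *
     (\<Prod>i<j. fact (k + i) / fact (2 * (k + i) + 1))"
proof (induction j)
  case (Suc j)
  have "schur_count {1..k + Suc j} = schur_count {1..k + j} * fact (\<Sum>{1..k + Suc j}) /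
      fact (\<Sum>{1..k + j}) * fact (k + j) / fact (2 * (k + j) + 1)"
    using schur_count_staircase_Suc[of "k + j"] by (simp only: add_Suc_right)
  then show ?case unfolding Suc by (simp del: add_Suc_right sum.cl_ivl_Suc fact_Suc)
qed simp

text \<open>For \<open>n \<ge> 4\<close> all factorials that depend on \<open>n\<close> are reduced
  to a few base factorials and linear factors; the identity is then a cancellation of nonzero
  terms.\<close>

lemma sum_schur_count_product_eq:
  assumes "n \<ge> 3"
  shows "(\<Sum>S\<in>Pow {1..n - 4}. schur_count (insert (n - 1) (insert (n - 3) S)) *
      schur_count (insert (n - 1) (insert (n - 3) ({1..n - 4} - S)))) =
    schur_count {1..n} * (catalan n * catalan (n - 2) / (2 * catalan (2 * n - 3)))"
proof (cases "n = 3")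
  \<comment> \<open>The only \<open>S\<close> is the empty set and \<open>n - 3 = 0\<close>, so the
    sum is the square of \<open>schur_count {2, 0}\<close>.\<close>
  case True
  have "{1..3} = {1, 2, 3 :: nat}" by auto
  then have "schur_count {1..3} = 2"
    by (simp add: schur_count_insert pair_factor_def fact_numeral)
  then show ?thesis using True
    by (simp add: schur_count_insert pair_factor_def fact_numeral catalan_fact)
next
  case False
  define k where "k = n - 4"
  have n: "n = k + 4" using assms False by (simp add: k_def)
  define M where "M = \<Sum>{1..k}"
  define r where "r = real k"
  define X :: real where "X = fact k"
  define Y :: real where "Y = fact (2 * k)"
  define Z :: real where "Z = fact (4 * k + 9)"
  define W :: real where "W = fact (M + (4 * k + 9))"
  \<comment> \<open>\<open>a i = k + i\<close> and \<open>b i = 2 * k + i\<close> are the linear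
    factors by which neighbouring factorials differ. Since \<open>b (2 * i) = 2 * a i\<close>, the
    even ones can be matched with factors of the other kind.\<close>
  define a where "a = (\<lambda>i. r + real i)"
  define b where "b = (\<lambda>i. 2 * r + real i)"
  have nz: "X \<noteq> 0" "Y \<noteq> 0" "Z \<noteq> 0" "W \<noteq> 0" "schur_count {1..k} \<noteq> 0" "fact M \<noteq> (0 :: real)"
    using schur_count_pos[of "{1..k}"] by (simp_all add: X_def Y_def Z_def W_def)
  have nz_ab: "a (Suc i) \<noteq> 0" "b (Suc i) \<noteq> 0" for i
    by (simp_all add: a_def b_def r_def add_nonneg_eq_0_iff)
  have X: "fact k = X" "fact (k + 1) = a 1 * X" "fact (k + 2) = a 2 * a 1 * X"
    "fact (k + 3) = a 3 * a 2 * a 1 * X" "fact (k + 4) = a 4 * a 3 * a 2 * a 1 * X"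
    "fact (k + 5) = a 5 * a 4 * a 3 * a 2 * a 1 * X"
    by (simp_all add: X_def a_def r_def eval_nat_numeral algebra_simps)
  have Y_step: "fact (2 * k + i + 1) = b (i + 1) * fact (2 * k + i)" for i
    by (simp add: b_def r_def algebra_simps)
  have b_even: "b (2 * i) = 2 * a i" for i by (simp add: a_def b_def)
  have Y1: "fact (2 * k + 1) = b 1 * Y" using Y_step[of 0] by (simp add: Y_def)
  have Y3: "fact (2 * k + 3) = b 3 * (2 * a 1) * b 1 * Y"
    using Y_step[of 1] Y_step[of 2] b_even[of 1] Y1 by (simp add: eval_nat_numeral)
  have Y4: "fact (2 * k + 4) = 2 * a 2 * (b 3 * (2 * a 1) * b 1 * Y)"
    using Y_step[of 3] b_even[of 2] Y3 by (simp add: eval_nat_numeral)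
  have Y5: "fact (2 * k + 5) = b 5 * (2 * a 2 * (b 3 * (2 * a 1) * b 1 * Y))"
    using Y_step[of 4] Y4 by (simp add: eval_nat_numeral)
  have Y6: "fact (2 * k + 6) = 2 * a 3 * (b 5 * (2 * a 2 * (b 3 * (2 * a 1) * b 1 * Y)))"
    using Y_step[of 5] b_even[of 3] Y5 by (simp add: eval_nat_numeral)
  have Y7: "fact (2 * k + 7) = b 7 * (2 * a 3 * (b 5 * (2 * a 2 * (b 3 * (2 * a 1) * b 1 * Y))))"
    using Y_step[of 6] Y6 by (simp add: eval_nat_numeral)
  have Y8: "fact (2 * k + 8) =
      2 * a 4 * (b 7 * (2 * a 3 * (b 5 * (2 * a 2 * (b 3 * (2 * a 1) * b 1 * Y)))))"
    using Y_step[of 7] b_even[of 4] Y7 by (simp add: eval_nat_numeral)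
  have "Suc (4 * k + 9) = 4 * k + 10" by simp
  then have "fact (4 * k + 10) = real (4 * k + 10) * Z"
    unfolding Z_def using fact_Suc[of "4 * k + 9", where 'a = real] by (simp only:)
  also have "real (4 * k + 10) = 2 * b 5" by (simp add: b_def r_def)
  finally have Z10: "fact (4 * k + 10) = 2 * b 5 * Z" .
  have M: "2 * real M = r * (r + 1)"
    unfolding M_def r_def
    by (induction k) (simp_all add: algebra_simps)
  have "Suc (M + (4 * k + 9)) = M + (4 * k + 10)" by simp
  then have "fact (M + (4 * k + 10)) = real (M + (4 * k + 10)) * W"
    unfolding W_def using fact_Suc[of "M + (4 * k + 9)", where 'a = real] by (simp only:)
  \<comment> \<open>This is the number \<open>(k + 4) * (k + 5) / 2\<close> of boxes of the
    staircase of size \<open>n = k + 4\<close>.\<close>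
  also have "real (M + (4 * k + 10)) = a 4 * a 5 / 2"
    using M by (simp add: a_def r_def algebra_simps)
  finally have W10: "fact (M + (4 * k + 10)) = a 4 * a 5 / 2 * W" .
  have sum4: "\<Sum>{1..k + 4} = M + (4 * k + 10)"
    by (simp add: M_def eval_nat_numeral)
  have staircase: "schur_count {1..k + 4} = schur_count {1..k} * (a 4 * a 5 / 2 * W) / fact M *
      (X / (b 1 * Y) * (a 1 * X / fact (2 * k + 3)) * (a 2 * a 1 * X / fact (2 * k + 5)) *
        (a 3 * a 2 * a 1 * X / fact (2 * k + 7)))"
  proof -
    have "(\<Prod>i<4. fact (k + i) / fact (2 * (k + i) + 1)) =
      fact k / fact (2 * k + 1) * (fact (k + 1) / fact (2 * k + 3)) *
      (fact (k + 2) / fact (2 * k + 5)) * (fact (k + 3) / (fact (2 * k + 7) :: real))"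
      by (simp add: eval_nat_numeral del: fact_Suc)
    then show ?thesis
      using schur_count_staircase_add[of k 4] unfolding sum4 W10 M_def[symmetric] X Y1 by (simp only:)
  qed
  have pf: "pair_factor (k + 3) (k + 1) = 1 / a 2"
    by (simp add: pair_factor_def a_def r_def field_simps)
  have q: "(\<Prod>s=1..k. pair_factor (k + 3) s * pair_factor (k + 1) s) =
      a 2 * a 1 * X / 2 * (a 3 * a 2 * a 1 * X / fact (2 * k + 3)) * (X * (a 1 * X / (b 1 * Y)))"
  proof -
    have index: "k + 3 - 1 = k + 2" "k + 2 - k = 2" "k + 3 + k = 2 * k + 3"
      "k + 1 - 1 = k" "k - k = 0" "k + 1 + k = 2 * k + 1"
      by simp_all
    have "(\<Prod>s=1..k. pair_factor (k + 3) s) = fact (k + 2) / 2 * (fact (k + 3) / fact (2 * k + 3))"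
      using prod_pair_factor[of k "k + 3"] unfolding index fact_2 by simp
    moreover have "(\<Prod>s=1..k. pair_factor (k + 1) s) = fact k * (fact (k + 1) / fact (2 * k + 1))"
      using prod_pair_factor[of k "k + 1"] unfolding index fact_0 by simp
    ultimately show ?thesis unfolding prod.distrib X Y1 by (simp only:)
  qed
  \<comment> \<open>The two large parts add up to \<open>p = 2 * k + 4\<close>, hence the lower
    index \<open>2 * p + 1 = 4 * k + 9\<close>.\<close>
  have choose: "real ((M + 2 * (2 * k + 4) + 1) choose (2 * (2 * k + 4) + 1)) = W / (Z * fact M)"
  proof -
    have "M + 2 * (2 * k + 4) + 1 = M + (4 * k + 9)" "2 * (2 * k + 4) + 1 = 4 * k + 9" by simp_all
    then show ?thesis
      using binomial_fact[of "4 * k + 9" "M + (4 * k + 9)", where 'a = real]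
      by (simp only: W_def Z_def) (simp del: fact_Suc)
  qed
  have cat: "catalan (k + 4) = fact (2 * k + 8) / (a 4 * a 3 * a 2 * a 1 * X * (a 5 * a 4 * a 3 * a 2 * a 1 * X))"
    "catalan (k + 2) = fact (2 * k + 4) / (a 2 * a 1 * X * (a 3 * a 2 * a 1 * X))"
    "catalan (2 * k + 5) = 2 * b 5 * Z / (fact (2 * k + 5) * fact (2 * k + 6))"
  proof -
    have index: "2 * (k + 4) = 2 * k + 8" "k + 4 + 1 = k + 5" "2 * (k + 2) = 2 * k + 4"
      "k + 2 + 1 = k + 3" "2 * (2 * k + 5) = 4 * k + 10" "2 * k + 5 + 1 = 2 * k + 6"
      by simp_all
    show "catalan (k + 4) = fact (2 * k + 8) / (a 4 * a 3 * a 2 * a 1 * X * (a 5 * a 4 * a 3 * a 2 * a 1 * X))"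
      "catalan (k + 2) = fact (2 * k + 4) / (a 2 * a 1 * X * (a 3 * a 2 * a 1 * X))"
      "catalan (2 * k + 5) = 2 * b 5 * Z / (fact (2 * k + 5) * fact (2 * k + 6))"
      by (simp_all only: catalan_fact index X Z10)
  qed
  have uv: "k + 3 + (k + 1) = 2 * k + 4" by simp
  have "(\<Sum>S\<in>Pow {1..k}. schur_count (insert (k + 3) (insert (k + 1) S)) *
      schur_count (insert (k + 3) (insert (k + 1) ({1..k} - S)))) =
     schur_count {1..k + 4} * (catalan (k + 4) * catalan (k + 2) / (2 * catalan (2 * k + 5)))"
  proof (subst sum_schur_count_product)
    show "(pair_factor (k + 3) (k + 1) / (fact (k + 3) * fact (k + 1)))\<^sup>2 *
        (\<Prod>s=1..k. pair_factor (k + 3) s * pair_factor (k + 1) s) * schur_count {1..k} *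
        (fact (k + 3 + (k + 1)))\<^sup>2 *
        real (\<Sum>{1..k} + 2 * (k + 3 + (k + 1)) + 1 choose (2 * (k + 3 + (k + 1)) + 1)) =
      schur_count {1..k + 4} * (catalan (k + 4) * catalan (k + 2) / (2 * catalan (2 * k + 5)))"
      unfolding uv M_def[symmetric] choose pf q cat staircase X Y3 Y4 Y5 Y6 Y7 Y8
      using nz nz_ab[of 0] nz_ab[of 1] nz_ab[of 2] nz_ab[of 3] nz_ab[of 4] nz_ab[of 6]
      by (simp add: divide_simps power2_eq_square)
  qed simp_all
  moreover have "n - 4 = k" "n - 3 = k + 1" "n - 1 = k + 3" "n - 2 = k + 2" "2 * n - 3 = 2 * k + 5"
    by (simp_all add: n)
  ultimately show ?thesis by (simp only: n)
qed

section \<open>Tableaux of the given shapes\<close>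

lemma part_staircase: "part (staircase n) i = (if 1 \<le> i then n + 1 - i else 0)"
proof (cases "1 \<le> i \<and> i \<le> n")
  case True
  then have "rev [1..<n + 1] ! (i - 1) = [1..<n + 1] ! (n - i)"
    by (subst rev_nth) auto
  also have "\<dots> = 1 + (n - i)" using True by (subst nth_upt) auto
  finally show ?thesis using True by (simp add: part_def staircase_def Suc_diff_le)
qed (auto simp: part_def staircase_def)

lemma shifted_diagram_staircase: "shifted_diagram (staircase n) [] = stair n"
  unfolding shifted_diagram_def part_staircase stair_def by (auto simp: part_def)

lemma shifted_diagram_truncated:
  "shifted_diagram (staircase n) (staircase 1) = stair n - {(1, n)}"
  unfolding shifted_diagram_def part_staircase stair_def by auto

theorem theorem1:
  fixes n :: nat
  assumes "n \<ge> 3"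
  shows "real (num_shifted_SYT (staircase n) []) = g_staircase n \<and>
         real (num_shifted_SYT (staircase n) (staircase 1)) =
           g_staircase n * (catalan n * catalan (n - 2) / (2 * catalan (2 * n - 3)))"
proof
  \<comment> \<open>The staircase has the set of parts \<open>{1..n}\<close>, so Schur's theorem
    applies directly.\<close>
  show "real (num_shifted_SYT (staircase n) []) = g_staircase n"
    using card_linear_exts_boxes[of "{1..n}"] unfolding boxes_atLeastAtMost schur_count_staircase
    by (simp add: num_shifted_SYT_def shifted_diagram_staircase card_standard_tableaux finite_stair)
next
  let ?P = "\<lambda>S. insert (n - 1) (insert (n - 3) S)"
  have count: "real (card (linear_exts before (boxes (?P S)))) = schur_count (?P S)"
    if "S \<subseteq> {1..n - 4}" for S
    using that by (intro card_linear_exts_boxes) (auto intro: finite_subset)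
  have "real (num_shifted_SYT (staircase n) (staircase 1)) =
      real (card (linear_exts before (stair n - {(1, n)})))"
    unfolding num_shifted_SYT_def shifted_diagram_truncated
    by (subst card_standard_tableaux) (simp_all add: finite_stair)
  also have "\<dots> = (\<Sum>S\<in>Pow {1..n - 4}. schur_count (?P S) * schur_count (?P ({1..n - 4} - S)))"
    unfolding card_linear_exts_truncated[OF assms] of_nat_sum of_nat_mult
    by (intro sum.cong refl) (simp only: count Pow_iff Diff_subset)
  also have "\<dots> = g_staircase n * (catalan n * catalan (n - 2) / (2 * catalan (2 * n - 3)))"
    unfolding sum_schur_count_product_eq[OF assms] schur_count_staircase ..
  finally show "real (num_shifted_SYT (staircase n) (staircase 1)) =
      g_staircase n * (catalan n * catalan (n - 2) / (2 * catalan (2 * n - 3)))" .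
qed

end
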